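(* Let $M$ be a loopless matroid of rank $r$ on an $n$-element ground set $E$. (1) The series $\operatorname{Mag}(M;q)$ is a rational function whose denominator divides $$\prod_{A\in\mathcal F(M),\,A\neq\varnothing}\bigl(1-(-1)^{r_M(A)}q^{|A|}\bigr).$$ (2) The first two coefficients of $\operatorname{Mag}(M;q)$ are $$\operatorname{Mag}(M;0)=R(M),\qquad [q]\operatorname{Mag}(M;q)=-2\sum_{e\in E,\ \{e\}\in\mathcal F(M)}R(M/e).$$ (3) As rational functions, $\operatorname{Mag}(M;q^{-1})=q^n\operatorname{Mag}(M;q)$. (4) The magnitude $\operatorname{Mag}(M;q)$ is regular at $q=1$, with $\operatorname{Mag}(M;1)=1$. (5) Write $\operatorname{Mag}(M;q)=P_M(q)/Q_M(q)$ in lowest terms, with $P_M,Q_M\in\mathbb Z[q]$ and $Q_M(0)=1$. Then both polynomials are palindromic, $\deg Q_M-\deg P_M=n$, and all roots of $Q_M$ are roots of unity other than $1$.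
   Context: All matroids are finite. $r_M$ is the rank function of $M$, $r(M)=r_M(E)$, $\mathcal F(M)$ is the lattice of flats, $M/e$ is the contraction. The characteristic polynomial is $\chi_M(x)=\sum_{S\subseteq E}(-1)^{|S|}x^{r(M)-r_M(S)}$, and $R(N)=(-1)^{r(N)}\chi_N(-1)$ for a loopless matroid $N$. For $w\in\mathbb Z_{\ge0}^E$ put $|w|=\sum_ew_e$, $\operatorname{wt}_M(w)=\max_B\sum_{e\in B}w_e$ over bases $B$ of $M$; the maximizing bases are the bases of the initial matroid $M_w$ on $E$. The motivic zeta function is $Z_M(x,T)=\sum_{w\in\mathbb Z_{\ge0}^E}\chi_{M_w}(x)x^{-r(M)-\operatorname{wt}_M(w)}T^{|w|}\in\mathbb Z[x^{\pm1}][[T]]$, and the magnitude is $\operatorname{Mag}(M;q)=Z_M(-1,q)\in\mathbb Z[[q]]$. A polynomial $f$ is palindromic if $q^{\deg f}f(q^{-1})=f(q)$. *)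

theory Defs
  imports
    Complex_Main
    "HOL-Library.Poly_Mapping"
    "HOL-Computational_Algebra.Computational_Algebra"
begin

section \<open>Matroids given by their bases\<close>

datatype 'a set_system = Set_System (ground: "'a set") (bases: "'a set set")

definition matroid :: "'a set_system \<Rightarrow> bool" where
  "matroid M \<longleftrightarrow>
     finite (ground M) \<and> bases M \<subseteq> Pow (ground M) \<and> bases M \<noteq> {} \<and>
     (\<forall>A\<in>bases M. \<forall>B\<in>bases M. \<forall>x\<in>A - B. \<exists>y\<in>B - A. insert y (A - {x}) \<in> bases M)"

text \<open>The independent sets are the subsets of bases, so the largest independent subset of \<open>S\<close>
  has the form \<open>B \<inter> S\<close>.\<close>

definition rank_of :: "'a set_system \<Rightarrow> 'a set \<Rightarrow> nat" where
  "rank_of M S = Max ((\<lambda>B. card (B \<inter> S)) ` bases M)"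

abbreviation total_rank :: "'a set_system \<Rightarrow> nat" where
  "total_rank M \<equiv> rank_of M (ground M)"

definition loopless :: "'a set_system \<Rightarrow> bool" where
  "loopless M \<longleftrightarrow> (\<forall>e\<in>ground M. rank_of M {e} \<noteq> 0)"

definition flats :: "'a set_system \<Rightarrow> 'a set set" where
  "flats M = {F. F \<subseteq> ground M \<and> (\<forall>e\<in>ground M - F. rank_of M F < rank_of M (insert e F))}"

text \<open>The bases of \<open>M/e\<close> are the sets \<open>B - {e}\<close> with \<open>B\<close> a basis of \<open>M\<close> meeting \<open>{e}\<close> in a basis
  of \<open>{e}\<close>; the rank condition makes this correct for a loop \<open>e\<close> as well.\<close>

definition contract :: "'a set_system \<Rightarrow> 'a \<Rightarrow> 'a set_system" where
  "contract M e = Set_System (ground M - {e})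
     {B - {e} |B. B \<in> bases M \<and> card (B \<inter> {e}) = rank_of M {e}}"

definition wt :: "'a set_system \<Rightarrow> ('a \<Rightarrow> nat) \<Rightarrow> nat" where
  "wt M w = Max ((\<lambda>B. \<Sum>e\<in>B. w e) ` bases M)"

definition initial_matroid :: "'a set_system \<Rightarrow> ('a \<Rightarrow> nat) \<Rightarrow> 'a set_system" where
  "initial_matroid M w = Set_System (ground M) {B \<in> bases M. (\<Sum>e\<in>B. w e) = wt M w}"

section \<open>Characteristic polynomial, motivic zeta function and magnitude\<close>

definition charpoly :: "'a set_system \<Rightarrow> int poly" where
  "charpoly M = (\<Sum>S\<in>Pow (ground M). monom ((-1) ^ card S) (total_rank M - rank_of M S))"

definition R :: "'a set_system \<Rightarrow> int" where
  "R N = (-1) ^ total_rank N * poly (charpoly N) (-1)"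

text \<open>Integral Laurent polynomials in \<open>x\<close> are finitely supported functions from exponents to
  coefficients, with the convolution product.\<close>

type_synonym laurent = "int \<Rightarrow>\<^sub>0 int"

definition laurent_of_poly :: "int poly \<Rightarrow> laurent" where
  "laurent_of_poly p = (\<Sum>i\<le>degree p. Poly_Mapping.single (int i) (coeff p i))"

text \<open>Evaluation at \<open>x = -1\<close>; the absolute value is harmless, since \<open>-1\<close> is its own inverse.\<close>

definition laurent_eval_m1 :: "laurent \<Rightarrow> int" where
  "laurent_eval_m1 p = (\<Sum>k\<in>Poly_Mapping.keys p. Poly_Mapping.lookup p k * (-1) ^ nat \<bar>k\<bar>)"

text \<open>Vectors indexed by \<open>E\<close> are represented by functions vanishing outside \<open>E\<close>, so that for finite
  \<open>E\<close> there are finitely many of any given total weight.\<close>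

definition weights :: "'a set \<Rightarrow> nat \<Rightarrow> ('a \<Rightarrow> nat) set" where
  "weights E k = {w. (\<forall>e. e \<notin> E \<longrightarrow> w e = 0) \<and> (\<Sum>e\<in>E. w e) = k}"

lemma finite_weights:
  assumes "finite E"
  shows "finite (weights E k)"
proof -
  have "weights E k \<subseteq> {w. \<forall>e. (e \<in> E \<longrightarrow> w e \<in> {..k}) \<and> (e \<notin> E \<longrightarrow> w e = 0)}"
    using assms by (auto simp: weights_def member_le_sum)
  moreover have "finite {w. \<forall>e. (e \<in> E \<longrightarrow> w e \<in> {..k}) \<and> (e \<notin> E \<longrightarrow> w e = 0)}"
    by (rule finite_set_of_finite_funs) (use assms in auto)
  ultimately show ?thesis
    by (rule finite_subset)
qed

definition zeta :: "'a set_system \<Rightarrow> laurent fps" where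
  "zeta M = Abs_fps (\<lambda>k. \<Sum>w\<in>weights (ground M) k.
     laurent_of_poly (charpoly (initial_matroid M w)) *
     Poly_Mapping.single (- int (total_rank M) - int (wt M w)) 1)"

definition Mag :: "'a set_system \<Rightarrow> int fps" where
  "Mag M = Abs_fps (\<lambda>k. laurent_eval_m1 (fps_nth (zeta M) k))"

section \<open>Rational functions\<close>

text \<open>Since \<open>Q(0) = 1\<close>, the denominator is a unit of \<open>\<int>[[q]]\<close> and has content 1, so coprimality over
  \<open>\<int>\<close> and over \<open>\<rat>\<close> agree and the pair \<open>(P, Q)\<close> is unique if it exists.\<close>

definition lowest_terms :: "int fps \<Rightarrow> int poly \<Rightarrow> int poly \<Rightarrow> bool" where
  "lowest_terms f P Q \<longleftrightarrow>
     coprime P Q \<and> poly Q 0 = 1 \<and> fps_of_poly P = fps_of_poly Q * f"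

definition ratfun_eval :: "int poly \<Rightarrow> int poly \<Rightarrow> 'a :: field_char_0 \<Rightarrow> 'a" where
  "ratfun_eval P Q z = poly (map_poly of_int P) z / poly (map_poly of_int Q) z"

text \<open>The indeterminate, as an element of the field of rational functions.\<close>

definition qvar :: "int poly fract" where
  "qvar = to_fract [:0, 1:]"

text \<open>\<open>reflect_poly f\<close> is \<open>q\<^sup>d f(1/q)\<close> with \<open>d = degree f\<close>.\<close>

definition palindromic :: "int poly \<Rightarrow> bool" where
  "palindromic f \<longleftrightarrow> reflect_poly f = f"

end

(*
  For A <= B let W(A, B) = sum over A <= S <= B of (-1)^(|S - A| + r(S) - r(A)). This is R of the minor
  M|B/A when A is a flat of M|B, and it vanishes otherwise. Splitting a weight vector w into its
  superlevel sets expresses the coefficient of w in Mag as a product of values of W along the chain of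
  these sets, so that the magnitudes Z_B of the restrictions M|B satisfy
     Z_B = sum over A <= B of (-1)^r(A) W(A, B) q^|A| Z_A.
  Solving for Z_B gives the denominator. Moebius inversion over the Boolean lattice turns the recursion
  into
     sum over A <= B of (-1)^|B - A| (1 - (-1)^r(B) q^|A|) Z_A = 0   for all B.
  This system determines all Z_B from Z_{} = 1 and is invariant under replacing Z_A by q^(-|A|) Z_A(1/q),
  which is the reciprocity law. Dividing the equations with r(B) even by 1 - q shows by induction
  that Z_B is regular at q = 1 with value 1. Palindromicity then follows from reciprocity and R(M) > 0.
*)

theory Submission
  imports Defs
begin

section \<open>Bases and rank\<close>

text \<open>The factorisation along superlevel sets reflects that the initial matroid of
  \<open>w\<close> is the direct sum of the minors between consecutive superlevel sets. No direct
  sum is built: a single basis adapted to a chain yields the rank function of the initial matroid,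
  and only ranks are needed afterwards. The series are then studied for a bare set function
  \<open>r\<close> with \<open>r {} = 0\<close>, which enters only through signs. Summing over all
  subsets instead of flats is what makes W a product of a zeta matrix and a sign-twisted Moebius
  matrix of the Boolean lattice; flats return only through the vanishing of W, which trims the
  denominator. A power series has no direct value at 1/q or at 1, so values are a relation between
  series and field elements, and reciprocity compares the values at the generic point
  \<open>qvar\<close> and at its inverse. At q = 1 and for even r(B) the coefficient of Z_B
  vanishes; after division by 1 - q it becomes |B|. All values being 1 then amounts to sum (-1)^|B -
  A| |A| = 0, which fails exactly for |B| = 1. Looplessness excludes that case: singletons have odd
  rank.\<close>

lemma matroid_finite:
  assumes "matroid M"
  shows "finite (ground M)" "finite (bases M)" "bases M \<noteq> {}"
    "\<And>B. B \<in> bases M \<Longrightarrow> B \<subseteq> ground M \<and> finite B"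
proof -
  show "finite (ground M)" "bases M \<noteq> {}" "\<And>B. B \<in> bases M \<Longrightarrow> B \<subseteq> ground M \<and> finite B"
    using assms unfolding matroid_def by (auto intro: finite_subset)
  show "finite (bases M)"
    using assms unfolding matroid_def by (auto intro: finite_subset)
qed

lemma basis_exchange:
  assumes "matroid M" "A \<in> bases M" "B \<in> bases M" "x \<in> A - B"
  obtains y where "y \<in> B - A" "insert y (A - {x}) \<in> bases M"
proof -
  have "\<exists>y\<in>B - A. insert y (A - {x}) \<in> bases M"
    using assms unfolding matroid_def by metis
  then show ?thesis
    using that by blast
qed

lemma card_bases_eq:
  assumes "matroid M" "A \<in> bases M" "B \<in> bases M"
  shows "card A = card B"
  using assms(2)
proof (induction "card (A - B)" arbitrary: A rule: less_induct)
  case less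
  have fin: "finite A"
    using matroid_finite(4)[OF assms(1)] less.prems by blast
  show ?case
  proof (cases "A - B = {}")
    case True
    have "B - A = {}"
    proof (rule ccontr)
      assume "B - A \<noteq> {}"
      then obtain x where "x \<in> B - A"
        by blast
      then show False
        using basis_exchange[OF assms(1,3) less.prems] True by blast
    qed
    with True show ?thesis
      by (metis Diff_eq_empty_iff subset_antisym)
  next
    case False
    then obtain x where x: "x \<in> A - B"
      by blast
    then obtain y where y: "y \<in> B - A" "insert y (A - {x}) \<in> bases M"
      using basis_exchange[OF assms(1) less.prems assms(3)] by blast
    have "insert y (A - {x}) - B = A - B - {x}"
      using y by blast
    then have "card (insert y (A - {x}) - B) < card (A - B)"
      using x fin by (metis card_Diff1_less finite_Diff)
    then have "card (insert y (A - {x})) = card B"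
      using less.hyps y by blast
    moreover have "card (insert y (A - {x})) = card A"
      using x y fin by (metis DiffD1 DiffD2 Diff_iff card.remove card_insert_disjoint finite_Diff)
    ultimately show ?thesis
      by simp
  qed
qed

lemma card_Int_le_rank_of:
  assumes "matroid M" "B \<in> bases M"
  shows "card (B \<inter> S) \<le> rank_of M S"
  unfolding rank_of_def using matroid_finite(2)[OF assms(1)] assms(2) by (intro Max_ge) auto

lemma rank_of_attained:
  assumes "matroid M"
  obtains B where "B \<in> bases M" "card (B \<inter> S) = rank_of M S"
proof -
  have "rank_of M S \<in> (\<lambda>B. card (B \<inter> S)) ` bases M"
    unfolding rank_of_def using matroid_finite[OF assms] by (intro Max_in) auto
  then show ?thesis
    using that by fastforce
qed

lemma rank_of_eqI:
  assumes "matroid M" "B \<in> bases M" "rank_of M S \<le> card (B \<inter> S)"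
  shows "rank_of M S = card (B \<inter> S)"
  using card_Int_le_rank_of[OF assms(1,2)] assms(3) by (rule le_antisym[rotated])

lemma rank_of_mono:
  assumes "matroid M" "S \<subseteq> T"
  shows "rank_of M S \<le> rank_of M T"
proof -
  obtain B where B: "B \<in> bases M" "card (B \<inter> S) = rank_of M S"
    using rank_of_attained[OF assms(1)] by blast
  have "card (B \<inter> S) \<le> card (B \<inter> T)"
    using matroid_finite(4)[OF assms(1) B(1)] assms(2) by (intro card_mono) auto
  then show ?thesis
    using card_Int_le_rank_of[OF assms(1) B(1), of T] B by linarith
qed

lemma rank_of_empty: "matroid M \<Longrightarrow> rank_of M {} = 0"
  by (rule rank_of_attained[of M "{}"]) auto

lemma rank_of_insert_le:
  assumes "matroid M"
  shows "rank_of M (insert e S) \<le> Suc (rank_of M S)"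
proof -
  obtain B where B: "B \<in> bases M" "card (B \<inter> insert e S) = rank_of M (insert e S)"
    using rank_of_attained[OF assms] by blast
  have "card (B \<inter> insert e S) \<le> card (insert e (B \<inter> S))"
    using matroid_finite(4)[OF assms B(1)] by (intro card_mono) auto
  also have "\<dots> \<le> Suc (card (B \<inter> S))"
    using matroid_finite(4)[OF assms B(1)] by (simp add: card_insert_if)
  finally show ?thesis
    using card_Int_le_rank_of[OF assms B(1), of S] B by linarith
qed

lemma card_basis_eq_total_rank:
  assumes "matroid M" "B \<in> bases M"
  shows "card B = total_rank M"
proof -
  obtain X where X: "X \<in> bases M" "card (X \<inter> ground M) = total_rank M"
    using rank_of_attained[OF assms(1)] by blast
  then show ?thesis
    using matroid_finite(4)[OF assms(1) X(1)] card_bases_eq[OF assms X(1)]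
    by (simp add: Int_absorb2)
qed

text \<open>If \<open>B\<close> meets \<open>D\<close> in fewer elements than \<open>X\<close> does,
  it has more elements outside \<open>D\<close>, since all bases have one size; so some element of
  \<open>B\<close> avoids both \<open>D\<close> and \<open>X\<close>. Exchanging it for an element
  of \<open>X\<close> loses nothing in \<open>D\<close> and brings \<open>B\<close> closer to
  \<open>X\<close>.\<close>

lemma basis_extending_trace:
  assumes M: "matroid M" and "B \<in> bases M" and X: "X \<in> bases M"
  shows "\<exists>B'\<in>bases M. B \<inter> D \<subseteq> B' \<inter> D \<and> card (X \<inter> D) \<le> card (B' \<inter> D)"
  using assms(2)
proof (induction "card (B - X)" arbitrary: B rule: less_induct)
  case less
  note fin = matroid_finite(4)[OF M]
  show ?case
  proof (cases "card (X \<inter> D) \<le> card (B \<inter> D)")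
    case True
    then show ?thesis
      using less.prems by blast
  next
    case False
    have "card B = card (B \<inter> D) + card (B - D)" "card X = card (X \<inter> D) + card (X - D)"
      using fin[OF less.prems] fin[OF X] by (metis card_Int_Diff)+
    then have "card (X - D) < card (B - D)"
      using False card_bases_eq[OF M less.prems X] by linarith
    then have "\<not> B - D \<subseteq> X - D"
      using fin[OF X] by (metis card_mono finite_Diff not_less)
    then obtain x where x: "x \<in> B - X" "x \<notin> D"
      by blast
    then obtain y where y: "y \<in> X - B" "insert y (B - {x}) \<in> bases M"
      using basis_exchange[OF M less.prems X] by blast
    have "insert y (B - {x}) - X = B - X - {x}"
      using y by blast
    then have "card (insert y (B - {x}) - X) < card (B - X)"
      using x fin[OF less.prems] by (metis card_Diff1_less finite_Diff)
    from less.hyps[OF this y(2)] show ?thesis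
      using x by blast
  qed
qed

text \<open>Repairing the trace on the largest set only enlarges the traces on the smaller ones, and
  these were already maximal. The lemma stands in for submodularity in everything that
  follows.\<close>

lemma basis_adapted_to_chain:
  fixes C :: "nat \<Rightarrow> 'a set"
  assumes M: "matroid M" and C: "\<And>i j. i \<le> j \<Longrightarrow> j \<le> n \<Longrightarrow> C i \<subseteq> C j"
  shows "\<exists>B\<in>bases M. \<forall>i\<le>n. card (B \<inter> C i) = rank_of M (C i)"
  using C
proof (induction n)
  case 0
  then show ?case
    using rank_of_attained[OF M, of "C 0"] by (metis le_zero_eq)
next
  case (Suc n)
  then obtain B where B: "B \<in> bases M" "\<forall>i\<le>n. card (B \<inter> C i) = rank_of M (C i)"
    by (meson le_Suc_eq)
  obtain X where X: "X \<in> bases M" "card (X \<inter> C (Suc n)) = rank_of M (C (Suc n))"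
    using rank_of_attained[OF M] by blast
  obtain B' where B': "B' \<in> bases M" "B \<inter> C (Suc n) \<subseteq> B' \<inter> C (Suc n)"
    "card (X \<inter> C (Suc n)) \<le> card (B' \<inter> C (Suc n))"
    using basis_extending_trace[OF M B(1) X(1)] by blast
  have "card (B' \<inter> C i) = rank_of M (C i)" if "i \<le> Suc n" for i
  proof (cases "i = Suc n")
    case True
    then show ?thesis
      using rank_of_eqI[OF M B'(1)] B' X by metis
  next
    case False
    then have "i \<le> n"
      using that by simp
    then have "B \<inter> C i \<subseteq> B' \<inter> C i"
      using B'(2) Suc.prems[of i "Suc n"] by auto
    then have "card (B \<inter> C i) \<le> card (B' \<inter> C i)"
      using matroid_finite(4)[OF M B'(1)] by (intro card_mono) auto
    then show ?thesis
      using rank_of_eqI[OF M B'(1)] B \<open>i \<le> n\<close> by metis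
  qed
  then show ?case
    using B'(1) by blast
qed

text \<open>Monotonicity of closure. If \<open>e\<close> raised the rank of \<open>S\<close>, a
  basis adapted to \<open>A\<close>, \<open>S\<close>, \<open>insert e S\<close> would contain
  \<open>e\<close>, and so would gain an element over \<open>A\<close> as well.\<close>

lemma rank_of_insert_eq_mono:
  assumes M: "matroid M" and "A \<subseteq> S" and e: "rank_of M (insert e A) = rank_of M A"
  shows "rank_of M (insert e S) = rank_of M S"
proof (rule ccontr)
  assume neq: "rank_of M (insert e S) \<noteq> rank_of M S"
  define C where "C = (\<lambda>i::nat. if i = 0 then A else if i = 1 then S else insert e S)"
  have "C i \<subseteq> C j" if "i \<le> j" for i j
    using that \<open>A \<subseteq> S\<close> by (auto simp: C_def)
  then obtain B where B: "B \<in> bases M" "\<forall>i\<le>2. card (B \<inter> C i) = rank_of M (C i)"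
    using basis_adapted_to_chain[OF M, of 2 C] by blast
  have cards: "card (B \<inter> A) = rank_of M A" "card (B \<inter> S) = rank_of M S"
    "card (B \<inter> insert e S) = rank_of M (insert e S)"
    using B(2)[rule_format, of 0] B(2)[rule_format, of 1] B(2)[rule_format, of 2]
    by (auto simp: C_def)
  have "e \<in> B" "e \<notin> S"
    using cards neq by (metis Int_insert_right_if0, metis insert_absorb)
  moreover have "finite B"
    using matroid_finite(4)[OF M B(1)] by simp
  ultimately have "card (B \<inter> insert e A) = Suc (card (B \<inter> A))"
    using \<open>A \<subseteq> S\<close> by (subst Int_insert_right_if1) (auto intro!: card_insert_disjoint)
  then show False
    using card_Int_le_rank_of[OF M B(1), of "insert e A"] cards e by simp
qed

section \<open>Initial matroids\<close>

definition superlevel :: "'a set \<Rightarrow> ('a \<Rightarrow> nat) \<Rightarrow> nat \<Rightarrow> 'a set" where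
  "superlevel B w t = {e \<in> B. t \<le> w e}"

lemma superlevel_antimono: "s \<le> t \<Longrightarrow> superlevel B w t \<subseteq> superlevel B w s"
  by (auto simp: superlevel_def)

lemma superlevel_0 [simp]: "superlevel B w 0 = B"
  by (simp add: superlevel_def)

lemma superlevel_eq_empty:
  assumes "\<And>e. e \<in> B \<Longrightarrow> w e < K"
  shows "superlevel B w K = {}"
  using assms by (auto simp: superlevel_def not_le)

lemma sum_weight_eq_sum_card:
  assumes "finite B" "B \<subseteq> E" "\<And>e. e \<in> E \<Longrightarrow> w e < K"
  shows "(\<Sum>e\<in>B. w e) = (\<Sum>t<K. card (B \<inter> superlevel E w (Suc t)))"
proof -
  have "w e = (\<Sum>t<K. if t < w e then 1 else 0)" if "e \<in> B" for e
  proof -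
    \<comment> \<open>Layer cake: \<open>w e\<close> counts the levels \<open>t\<close> strictly
      below it.\<close>
    have "{..<K} \<inter> {t. t < w e} = {..<w e}"
      using assms that by force
    then show ?thesis
      by (simp add: sum.If_cases)
  qed
  then have "(\<Sum>e\<in>B. w e) = (\<Sum>e\<in>B. \<Sum>t<K. if t < w e then 1 else 0)"
    by (rule sum.cong[OF refl])
  also have "\<dots> = (\<Sum>t<K. \<Sum>e\<in>B. if t < w e then 1 else 0)"
    by (rule sum.swap)
  also have "\<dots> = (\<Sum>t<K. card (B \<inter> superlevel E w (Suc t)))"
  proof (rule sum.cong[OF refl])
    fix t
    have "B \<inter> superlevel E w (Suc t) = B \<inter> {e. t < w e}"
      using assms by (auto simp: superlevel_def)
    then show "(\<Sum>e\<in>B. if t < w e then 1 else 0) = card (B \<inter> superlevel E w (Suc t))"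
      using assms(1) by (simp add: sum.If_cases)
  qed
  finally show ?thesis .
qed

lemma card_Int_eq_sum_layers:
  fixes F :: "nat \<Rightarrow> 'a set"
  assumes "finite B" "\<And>s t. s \<le> t \<Longrightarrow> F t \<subseteq> F s"
  shows "card (B \<inter> F 0) = (\<Sum>t<K. card (B \<inter> (F t - F (Suc t)))) + card (B \<inter> F K)"
proof (induction K)
  case (Suc K)
  have "B \<inter> F K = B \<inter> (F K - F (Suc K)) \<union> B \<inter> F (Suc K)"
    using assms(2)[of K "Suc K"] by auto
  then have "card (B \<inter> F K) = card (B \<inter> (F K - F (Suc K))) + card (B \<inter> F (Suc K))"
    using assms(1) by (metis Diff_disjoint Int_assoc card_Un_disjoint finite_Int inf_bot_right inf_commute inf_left_commute)
  then show ?case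
    using Suc by simp
qed simp

text \<open>A basis adapted to the chain of superlevel sets, refined by their traces on \<open>S\<close>, has maximal
  weight and, among the bases of maximal weight, meets \<open>S\<close> in as many elements as possible.\<close>

lemma initial_matroid_rank:
  assumes M: "matroid M" and E: "E = ground M" and S: "S \<subseteq> E" and K: "\<And>e. e \<in> E \<Longrightarrow> w e < K"
  defines "F \<equiv> superlevel E w"
  shows "wt M w = (\<Sum>t<K. rank_of M (F (Suc t)))"
    and "rank_of (initial_matroid M w) S + (\<Sum>t<K. rank_of M (F (Suc t))) =
      (\<Sum>t<K. rank_of M (F (Suc t) \<union> (S \<inter> F t)))"
proof -
  note fin = matroid_finite(4)[OF M]
  have weight: "(\<Sum>e\<in>B. w e) = (\<Sum>t<K. card (B \<inter> F (Suc t)))" if "B \<in> bases M" for B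
    using sum_weight_eq_sum_card[of B E w K] fin[OF that] K unfolding E F_def by blast
  have anti: "F t \<subseteq> F s" if "s \<le> t" for s t
    using that by (simp add: F_def superlevel_antimono)
  \<comment> \<open>\<open>S\<close> is cut into the layers \<open>F t - F (Suc t)\<close>, on which
    \<open>w\<close> is constant, and each piece is joined to the trace on \<open>F (Suc t)\<close>.
    For bases of equal weight, comparing traces on \<open>S\<close> thus becomes a termwise
    comparison with ranks.\<close>
  have split: "card (B \<inter> S) + (\<Sum>t<K. card (B \<inter> F (Suc t))) =
      (\<Sum>t<K. card (B \<inter> (F (Suc t) \<union> (S \<inter> F t))))" if "B \<in> bases M" for B
  proof -
    have "F K = {}"
      unfolding F_def using K by (rule superlevel_eq_empty)
    moreover have "B \<inter> S \<inter> F 0 = B \<inter> S"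
      using S unfolding F_def by auto
    ultimately have "card (B \<inter> S) = (\<Sum>t<K. card (B \<inter> S \<inter> (F t - F (Suc t))))"
      using card_Int_eq_sum_layers[of "B \<inter> S" F K] fin[OF that] anti by simp
    moreover have "card (B \<inter> S \<inter> (F t - F (Suc t))) + card (B \<inter> F (Suc t)) =
        card (B \<inter> (F (Suc t) \<union> (S \<inter> F t)))" for t
    proof -
      have "B \<inter> (F (Suc t) \<union> (S \<inter> F t)) = B \<inter> S \<inter> (F t - F (Suc t)) \<union> B \<inter> F (Suc t)"
        by auto
      then show ?thesis
        using fin[OF that] by (subst card_Un_disjoint[symmetric]) auto
    qed
    ultimately show ?thesis
      by (simp add: sum.distrib[symmetric])
  qed
  \<comment> \<open>The chain ascends from \<open>F K = {}\<close> to \<open>F 0 = E\<close>: index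
    \<open>2 * j\<close> is \<open>F (K - j)\<close>, and the odd index after it adds the part of
    \<open>S\<close> in the next larger superlevel set.\<close>
  define C where "C i = (if even i then F (K - i div 2) else F (K - i div 2) \<union> (S \<inter> F (K - i div 2 - 1)))" for i
  have C_mono: "C i \<subseteq> C j" if "i \<le> j" for i j
  proof (rule lift_Suc_mono_le[of C, OF _ that])
    fix i
    show "C i \<subseteq> C (Suc i)"
      using anti[of "K - i div 2 - 1" "K - i div 2"] by (auto simp: C_def)
  qed
  obtain B where B: "B \<in> bases M" "\<And>i. i \<le> 2 * K \<Longrightarrow> card (B \<inter> C i) = rank_of M (C i)"
    using basis_adapted_to_chain[OF M, of "2 * K" C] C_mono by blast
  have B_F: "card (B \<inter> F (Suc t)) = rank_of M (F (Suc t))"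
    and B_FS: "card (B \<inter> (F (Suc t) \<union> (S \<inter> F t))) = rank_of M (F (Suc t) \<union> (S \<inter> F t))"
    if "t < K" for t
    using B(2)[of "2 * (K - Suc t)"] B(2)[of "Suc (2 * (K - Suc t))"] that
    by (simp_all add: C_def Suc_diff_Suc)
  have le: "(\<Sum>e\<in>X. w e) \<le> (\<Sum>t<K. rank_of M (F (Suc t)))" if "X \<in> bases M" for X
    unfolding weight[OF that] by (intro sum_mono card_Int_le_rank_of[OF M that])
  have eq: "(\<Sum>e\<in>B. w e) = (\<Sum>t<K. rank_of M (F (Suc t)))"
    unfolding weight[OF B(1)] by (intro sum.cong) (auto simp: B_F)
  show wt: "wt M w = (\<Sum>t<K. rank_of M (F (Suc t)))"
    unfolding wt_def
  proof (rule Max_eqI)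
    show "finite ((\<lambda>B. \<Sum>e\<in>B. w e) ` bases M)"
      using matroid_finite(2)[OF M] by simp
  qed (use le eq B(1) in force)+
  have "B \<in> bases (initial_matroid M w)"
    using B(1) eq wt by (simp add: initial_matroid_def)
  moreover have "card (X \<inter> S) \<le> card (B \<inter> S)" if "X \<in> bases (initial_matroid M w)" for X
  proof -
    have X: "X \<in> bases M" "(\<Sum>e\<in>X. w e) = wt M w"
      using that by (auto simp: initial_matroid_def)
    have "card (X \<inter> S) + (\<Sum>t<K. card (X \<inter> F (Suc t))) \<le> (\<Sum>t<K. rank_of M (F (Suc t) \<union> (S \<inter> F t)))"
      unfolding split[OF X(1)] by (intro sum_mono card_Int_le_rank_of[OF M X(1)])
    also have "\<dots> = card (B \<inter> S) + (\<Sum>t<K. card (B \<inter> F (Suc t)))"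
      unfolding split[OF B(1)] by (intro sum.cong) (auto simp: B_FS)
    finally show ?thesis
      using X(2) wt eq weight[OF X(1)] weight[OF B(1)] by linarith
  qed
  moreover have "finite (bases (initial_matroid M w))"
    using matroid_finite(2)[OF M] by (simp add: initial_matroid_def)
  ultimately have "rank_of (initial_matroid M w) S = card (B \<inter> S)"
    unfolding rank_of_def by (intro Max_eqI) auto
  then show "rank_of (initial_matroid M w) S + (\<Sum>t<K. rank_of M (F (Suc t))) =
      (\<Sum>t<K. rank_of M (F (Suc t) \<union> (S \<inter> F t)))"
    using split[OF B(1)] by (simp add: B_F B_FS)
qed

lemma bases_initial_matroid_nonempty:
  assumes M: "matroid M"
  shows "bases (initial_matroid M w) \<noteq> {}"
proof -
  have "wt M w \<in> (\<lambda>B. \<Sum>e\<in>B. w e) ` bases M"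
    unfolding wt_def using matroid_finite[OF M] by (intro Max_in) auto
  then show ?thesis
    by (auto simp: initial_matroid_def)
qed

lemma total_rank_initial_matroid:
  assumes M: "matroid M"
  shows "total_rank (initial_matroid M w) = total_rank M"
proof -
  have "card (B \<inter> ground M) = total_rank M" if "B \<in> bases (initial_matroid M w)" for B
    using that card_basis_eq_total_rank[OF M] matroid_finite(4)[OF M]
    by (simp add: initial_matroid_def Int_absorb2)
  then have "(\<lambda>B. card (B \<inter> ground M)) ` bases (initial_matroid M w) = {total_rank M}"
    using bases_initial_matroid_nonempty[OF M, of w] by auto
  then show ?thesis
    by (simp add: rank_of_def initial_matroid_def)
qed

section \<open>The series attached to a set function\<close>

text \<open>The invariant \<open>R\<close> of the minor obtained by restricting to \<open>B\<close> and contracting \<open>A\<close>, for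
  arbitrary \<open>A \<subseteq> B\<close>.\<close>

definition minor_sum :: "('a set \<Rightarrow> nat) \<Rightarrow> 'a set \<Rightarrow> 'a set \<Rightarrow> int" where
  "minor_sum r A B = (\<Sum>S\<in>Pow (B - A). (-1) ^ (card S + r (A \<union> S) + r A))"

text \<open>The signs multiply to (-1)^wt, and the other factors are the invariants \<open>R\<close>
  of the layer minors. \<open>K\<close> is a cutoff above the largest weight, which keeps the
  product finite.\<close>

definition chain_coeff :: "('a set \<Rightarrow> nat) \<Rightarrow> nat \<Rightarrow> 'a set \<Rightarrow> ('a \<Rightarrow> nat) \<Rightarrow> int" where
  "chain_coeff r K B w = (\<Prod>t<K. (-1) ^ r (superlevel B w (Suc t)) *
     minor_sum r (superlevel B w (Suc t)) (superlevel B w t))"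

text \<open>The cutoff \<open>Suc k\<close> exceeds every entry of a vector of total weight
  \<open>k\<close>.\<close>

definition mag_series :: "('a set \<Rightarrow> nat) \<Rightarrow> 'a set \<Rightarrow> int fps" where
  "mag_series r B = Abs_fps (\<lambda>k. \<Sum>w\<in>weights B k. chain_coeff r (Suc k) B w)"

lemma neg_one_power_double [simp]: "(-1 :: 'b :: ring_1) ^ (n + n) = 1"
  by (simp flip: mult_2 add: power_mult)

lemma minor_sum_self [simp]: "minor_sum r A A = 1"
  by (simp add: minor_sum_def)

lemma sum_Pow_Un:
  assumes "A \<inter> B = {}"
  shows "(\<Sum>S\<in>Pow (A \<union> B). f S) = (\<Sum>S\<in>Pow A. \<Sum>T\<in>Pow B. f (S \<union> T))"
proof -
  have "(\<Sum>S\<in>Pow (A \<union> B). f S) = (\<Sum>(S, T)\<in>Pow A \<times> Pow B. f (S \<union> T))"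
    by (rule sum.reindex_bij_witness[of _ "\<lambda>(S, T). S \<union> T" "\<lambda>S. (S \<inter> A, S \<inter> B)"])
      (use assms in \<open>auto simp: Int_Un_distrib[symmetric] intro!: arg_cong[of _ _ f]\<close>)
  then show ?thesis
    by (simp add: sum.cartesian_product)
qed

text \<open>A subset of \<open>F 0 - F K\<close> is a free choice of one subset per layer. This is
  the multiplicativity of \<open>R\<close> over the direct sum of layer minors.\<close>

lemma sum_Pow_layers:
  fixes F :: "nat \<Rightarrow> 'a set" and \<phi> :: "nat \<Rightarrow> 'a set \<Rightarrow> int"
  assumes anti: "\<And>s t. s \<le> t \<Longrightarrow> F t \<subseteq> F s"
  shows "(\<Sum>S\<in>Pow (F 0 - F K). \<Prod>t<K. \<phi> t (S \<inter> (F t - F (Suc t)))) =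
    (\<Prod>t<K. \<Sum>S\<in>Pow (F t - F (Suc t)). \<phi> t S)"
proof (induction K)
  case (Suc K)
  have "F 0 - F (Suc K) = (F 0 - F K) \<union> (F K - F (Suc K))"
    using anti[of 0 K] anti[of K "Suc K"] by auto
  then have "(\<Sum>S\<in>Pow (F 0 - F (Suc K)). \<Prod>t<Suc K. \<phi> t (S \<inter> (F t - F (Suc t)))) =
      (\<Sum>S\<in>Pow (F 0 - F K). \<Sum>T\<in>Pow (F K - F (Suc K)).
        \<Prod>t<Suc K. \<phi> t ((S \<union> T) \<inter> (F t - F (Suc t))))"
    by (simp only:) (rule sum_Pow_Un, auto)
  also have "\<dots> = (\<Sum>S\<in>Pow (F 0 - F K). \<Sum>T\<in>Pow (F K - F (Suc K)).
        (\<Prod>t<K. \<phi> t (S \<inter> (F t - F (Suc t)))) * \<phi> K T)"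
  proof (intro sum.cong refl)
    fix S T
    assume S: "S \<in> Pow (F 0 - F K)" and T: "T \<in> Pow (F K - F (Suc K))"
    have "(S \<union> T) \<inter> (F t - F (Suc t)) = S \<inter> (F t - F (Suc t))" if "t < K" for t
      using T anti[of "Suc t" K] that by auto
    moreover have "(S \<union> T) \<inter> (F K - F (Suc K)) = T"
      using S T by auto
    ultimately show "(\<Prod>t<Suc K. \<phi> t ((S \<union> T) \<inter> (F t - F (Suc t)))) =
        (\<Prod>t<K. \<phi> t (S \<inter> (F t - F (Suc t)))) * \<phi> K T"
      by simp
  qed
  also have "\<dots> = (\<Prod>t<Suc K. \<Sum>S\<in>Pow (F t - F (Suc t)). \<phi> t S)"
    by (simp add: sum_product[symmetric] Suc.IH)
  finally show ?case .
qed simp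

text \<open>Above the largest weight both superlevel sets are empty, and such a factor is 1 because
  \<open>r {} = 0\<close>.\<close>

lemma chain_coeff_Suc_eq:
  assumes "r {} = 0" "\<And>e. e \<in> B \<Longrightarrow> w e < K" "K \<le> L"
  shows "chain_coeff r L B w = chain_coeff r K B w"
  using assms(3)
proof (induction L rule: dec_induct)
  case (step L)
  have "superlevel B w L = {}" "superlevel B w (Suc L) = {}"
    using assms(2) step.hyps by (force simp: superlevel_def)+
  then show ?case
    using step.IH assms(1) by (simp add: chain_coeff_def)
qed simp

section \<open>Recursion over the support of a weight vector\<close>

lemma weights_le:
  assumes "finite B" "w \<in> weights B k"
  shows "w e \<le> k"
  using assms by (cases "e \<in> B") (auto simp: weights_def member_le_sum)

text \<open>The factor \<open>t = 0\<close> is split off; the rest is the chain of the support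
  \<open>A\<close> for the vector lowered by 1. Truncated subtraction leaves the zeros outside
  \<open>A\<close> unchanged.\<close>

lemma chain_coeff_rec:
  fixes B w
  defines "A \<equiv> superlevel B w 1"
  shows "chain_coeff r (Suc K) B w =
    (-1) ^ r A * minor_sum r A B * chain_coeff r K A (\<lambda>e. w e - 1)"
proof -
  have "superlevel B w (Suc t) = superlevel A (\<lambda>e. w e - 1) t" for t
    by (auto simp: superlevel_def A_def)
  then show ?thesis
    by (simp add: chain_coeff_def prod.lessThan_Suc_shift del: prod.lessThan_Suc)
qed

lemma sum_weights_support:
  assumes B: "finite B" and A: "A \<subseteq> B"
  shows "(\<Sum>w\<in>{w \<in> weights B k. superlevel B w 1 = A}. g (\<lambda>e. w e - 1)) =
    (if card A \<le> k then \<Sum>w\<in>weights A (k - card A). g w else 0)"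
proof -
  have finA: "finite A"
    using assms finite_subset by blast
  have support: "(\<forall>e. e \<notin> A \<longrightarrow> w e = 0) \<and> (\<forall>e\<in>A. 1 \<le> w e) \<and> (\<Sum>e\<in>A. w e) = k"
    if "w \<in> weights B k" "superlevel B w 1 = A" for w
  proof -
    have "w e = 0" if "e \<notin> A" for e
      using \<open>w \<in> weights B k\<close> \<open>superlevel B w 1 = A\<close> that
      by (auto simp: superlevel_def weights_def)
    moreover from this have "(\<Sum>e\<in>B. w e) = (\<Sum>e\<in>A. w e)"
      using A B by (intro sum.mono_neutral_right) auto
    ultimately show ?thesis
      using that by (auto simp: superlevel_def weights_def)
  qed
  have shift: "(\<Sum>e\<in>A. w e) = card A + (\<Sum>e\<in>A. w e - 1)" if "\<forall>e\<in>A. 1 \<le> w e" for w :: "'a \<Rightarrow> nat"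
  proof -
    have "(\<Sum>e\<in>A. w e) = (\<Sum>e\<in>A. 1 + (w e - 1))"
      using that by (intro sum.cong) auto
    then show ?thesis
      by (simp only: sum.distrib) simp
  qed
  show ?thesis
  proof (cases "card A \<le> k")
    case True
    have "(\<Sum>w\<in>{w \<in> weights B k. superlevel B w 1 = A}. g (\<lambda>e. w e - 1)) =
        (\<Sum>w\<in>weights A (k - card A). g w)"
    proof (rule sum.reindex_bij_witness[of _ "\<lambda>w e. if e \<in> A then w e + 1 else 0" "\<lambda>w e. w e - 1"])
      fix w
      assume "w \<in> {w \<in> weights B k. superlevel B w 1 = A}"
      then have w: "\<forall>e. e \<notin> A \<longrightarrow> w e = 0" "\<forall>e\<in>A. 1 \<le> w e" "(\<Sum>e\<in>A. w e) = k"
        using support by auto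
      then show "(\<lambda>e. if e \<in> A then w e - 1 + 1 else 0) = w"
        by fastforce
      show "(\<lambda>e. w e - 1) \<in> weights A (k - card A)"
        using w shift[OF w(2)] by (auto simp: weights_def)
    next
      fix w
      assume w: "w \<in> weights A (k - card A)"
      then show "(\<lambda>e. (if e \<in> A then w e + 1 else 0) - 1) = w"
        by (auto simp: weights_def)
      have "(\<Sum>e\<in>B. if e \<in> A then w e + 1 else 0) = (\<Sum>e\<in>A. w e + 1)"
        using A B by (simp add: sum.If_cases Int_absorb1)
      also have "\<dots> = k"
        using w True by (simp only: sum.distrib) (simp add: weights_def)
      finally show "(\<lambda>e. if e \<in> A then w e + 1 else 0) \<in> {w \<in> weights B k. superlevel B w 1 = A}"
        using A by (auto simp: weights_def superlevel_def)
    qed simp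
    with True show ?thesis
      by simp
  next
    case False
    have "{w \<in> weights B k. superlevel B w 1 = A} = {}"
    proof (rule ccontr)
      assume "{w \<in> weights B k. superlevel B w 1 = A} \<noteq> {}"
      then obtain w where "\<forall>e\<in>A. 1 \<le> w e" "(\<Sum>e\<in>A. w e) = k"
        using support by blast
      then show False
        using shift[of w] False by simp
    qed
    with False show ?thesis
      by (simp only: sum.empty if_False)
  qed
qed

text \<open>A nonzero weight vector is the indicator vector of its support plus a smaller weight vector.\<close>

lemma mag_series_rec:
  assumes r: "r {} = 0" and B: "finite B"
  shows "mag_series r B =
    (\<Sum>A\<in>Pow B. of_int ((-1) ^ r A * minor_sum r A B) * fps_X ^ card A * mag_series r A)"
proof (rule fps_ext)
  fix k
  let ?c = "\<lambda>A. (-1) ^ r A * minor_sum r A B"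
  \<comment> \<open>The cutoff is raised by one, so that \<open>Suc k\<close> remains after the
    bottom factor is split off.\<close>
  have "mag_series r B $ k = (\<Sum>w\<in>weights B k. chain_coeff r (Suc (Suc k)) B w)"
    unfolding mag_series_def fps_nth_Abs_fps
    by (intro sum.cong refl chain_coeff_Suc_eq[where r = r, OF r, symmetric])
      (use weights_le[OF B] in \<open>auto simp: less_Suc_eq_le\<close>)
  also have "\<dots> = (\<Sum>A\<in>Pow B. \<Sum>w\<in>{w \<in> weights B k. superlevel B w 1 = A}.
      chain_coeff r (Suc (Suc k)) B w)"
    by (rule sum.group[symmetric]) (use B finite_weights[OF B] in \<open>auto simp: superlevel_def\<close>)
  also have "\<dots> = (\<Sum>A\<in>Pow B. \<Sum>w\<in>{w \<in> weights B k. superlevel B w 1 = A}.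
      ?c A * chain_coeff r (Suc k) A (\<lambda>e. w e - 1))"
    by (intro sum.cong refl) (auto simp: chain_coeff_rec)
  also have "\<dots> = (\<Sum>A\<in>Pow B. ?c A * (if card A \<le> k then
      \<Sum>w\<in>weights A (k - card A). chain_coeff r (Suc k) A w else 0))"
    by (intro sum.cong refl, subst sum_distrib_left[symmetric], subst sum_weights_support[OF B]) auto
  \<comment> \<open>The series of \<open>A\<close> uses the cutoff \<open>Suc (k - card A)\<close>,
    which still exceeds all entries; lowering the cutoff to it changes nothing.\<close>
  also have "\<dots> = (\<Sum>A\<in>Pow B. ?c A * (if card A \<le> k then mag_series r A $ (k - card A) else 0))"
  proof (intro sum.cong refl arg_cong2[of _ _ _ _ "(*)"] if_cong)
    fix A
    assume "A \<in> Pow B" and "card A \<le> k"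
    then have "finite A"
      using B finite_subset by blast
    show "(\<Sum>w\<in>weights A (k - card A). chain_coeff r (Suc k) A w) = mag_series r A $ (k - card A)"
      unfolding mag_series_def fps_nth_Abs_fps
      by (intro sum.cong refl chain_coeff_Suc_eq[where r = r, OF r])
        (use weights_le[OF \<open>finite A\<close>] in \<open>auto simp: less_Suc_eq_le\<close>)
  qed
  also have "\<dots> = (\<Sum>A\<in>Pow B. of_int (?c A) * fps_X ^ card A * mag_series r A) $ k"
  proof -
    have "(of_int c * fps_X ^ n * f) $ k = c * (if n \<le> k then f $ (k - n) else 0)" for c n and f :: "int fps"
    proof -
      have "of_int c * fps_X ^ n * f = fps_const c * (fps_X ^ n * f)"
        by (simp add: fps_of_int[symmetric] mult.assoc)
      then show ?thesis
        by (simp only: fps_mult_left_const_nth fps_X_power_mult_nth) auto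
    qed
    then show ?thesis
      by (simp only: fps_sum_nth)
  qed
  finally show "mag_series r B $ k = \<dots>" .
qed

lemma mag_series_empty [simp]:
  assumes "r {} = 0"
  shows "mag_series r {} = 1"
proof (rule fps_ext)
  fix k
  have "weights ({} :: 'a set) k = (if k = 0 then {\<lambda>_. 0} else {})"
    by (auto simp: weights_def)
  then show "mag_series r {} $ k = (1 :: int fps) $ k"
    using assms by (simp add: mag_series_def chain_coeff_def superlevel_def)
qed

section \<open>Moebius inversion of the recursion\<close>

lemma minor_sum_alt:
  assumes "finite B" "A \<subseteq> B"
  shows "minor_sum r A B = (\<Sum>S\<in>{S. A \<subseteq> S \<and> S \<subseteq> B}. (-1) ^ (card S - card A + r S + r A))"
  unfolding minor_sum_def
proof (rule sum.reindex_bij_witness[of _ "\<lambda>S. S - A" "\<lambda>S. A \<union> S"])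
  fix S
  assume "S \<in> Pow (B - A)"
  then have "card (A \<union> S) = card A + card S"
    using assms by (intro card_Un_disjoint) (auto intro: finite_subset)
  then show "(-1) ^ (card (A \<union> S) - card A + r (A \<union> S) + r A) =
      (-1 :: int) ^ (card S + r (A \<union> S) + r A)"
    by simp
qed (use assms in auto)

text \<open>The matrix \<open>minor_sum\<close> is the product of the zeta matrix of the Boolean lattice with the
  conjugate of its Moebius matrix by the signs \<open>(-1) ^ r A\<close>, so the recursion can be inverted.\<close>

lemma mag_series_moebius:
  assumes r: "r {} = 0" and B: "finite B"
  shows "(\<Sum>A\<in>Pow B. (-1) ^ (card B - card A) * (1 - (-1) ^ r B * fps_X ^ card A) *
    mag_series r A) = 0"
proof -
  \<comment> \<open>\<open>f T\<close> collects the terms of the recursion with middle set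
    \<open>T\<close> in \<open>minor_sum\<close>; the two signs (-1)^r(A) cancel. So the series is
    the subset sum of \<open>f\<close>, and inversion writes \<open>f B\<close> as an alternating
    sum of series.\<close>
  define f :: "'a set \<Rightarrow> int fps" where
    "f S = (-1) ^ r S * (\<Sum>A\<in>Pow S. (-1) ^ (card S - card A) * fps_X ^ card A * mag_series r A)" for S
  have "mag_series r S = sum f (Pow S)" if S: "finite S" for S
  proof -
    have "mag_series r S = (\<Sum>A\<in>Pow S. \<Sum>T\<in>{T \<in> Pow S. A \<subseteq> T}.
        (-1) ^ r T * (-1) ^ (card T - card A) * fps_X ^ card A * mag_series r A)"
      (is "_ = (\<Sum>A\<in>Pow S. ?g A)")
    proof (subst mag_series_rec[of r, OF r S], intro sum.cong refl)
      fix A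
      assume "A \<in> Pow S"
      then have "of_int ((-1) ^ r A * minor_sum r A S) =
          (\<Sum>T\<in>{T \<in> Pow S. A \<subseteq> T}. (-1) ^ r T * (-1) ^ (card T - card A) :: int fps)"
        using S by (simp add: minor_sum_alt sum_distrib_left power_add conj_commute mult_ac)
      then show "of_int ((-1) ^ r A * minor_sum r A S) * fps_X ^ card A * mag_series r A = ?g A"
        by (simp add: sum_distrib_right)
    qed
    also have "\<dots> = (\<Sum>T\<in>Pow S. \<Sum>A\<in>{A \<in> Pow S. A \<subseteq> T}.
        (-1) ^ r T * (-1) ^ (card T - card A) * fps_X ^ card A * mag_series r A)"
      using S by (intro sum.swap_restrict) auto
    also have "\<dots> = sum f (Pow S)"
      unfolding f_def sum_distrib_left
      by (intro sum.cong refl) (auto simp: mult.assoc)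
    finally show ?thesis .
  qed
  from inclusion_exclusion_mobius[of "mag_series r" f, OF this B]
  have "(\<Sum>A\<in>Pow B. (-1) ^ (card B - card A) * mag_series r A) - f B = 0"
    by simp
  then show ?thesis
    by (simp add: f_def sum_distrib_left sum_subtractf algebra_simps)
qed

section \<open>Values of rational power series\<close>

abbreviation ipoly :: "int poly \<Rightarrow> 'b::field_char_0 \<Rightarrow> 'b" where
  "ipoly p z \<equiv> poly (map_poly of_int p) z"

lemma ipoly_simps [simp]:
  "ipoly (p + q) z = ipoly p z + ipoly q z"
  "ipoly (p * q) z = ipoly p z * ipoly q z"
  "ipoly (- p) z = - ipoly p z"
  "ipoly (p - q) z = ipoly p z - ipoly q z"
  "ipoly (monom c n) z = of_int c * z ^ n"
proof -
  have "map_poly of_int (p + q) = (map_poly of_int p + map_poly of_int q :: 'a poly)"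
    "map_poly of_int (p * q) = (map_poly of_int p * map_poly of_int q :: 'a poly)"
    "map_poly of_int (- p) = - (map_poly of_int p :: 'a poly)"
    "map_poly of_int (p - q) = (map_poly of_int p - map_poly of_int q :: 'a poly)"
    by (simp_all add: poly_eq_iff coeff_map_poly coeff_mult)
  then show "ipoly (p + q) z = ipoly p z + ipoly q z"
    "ipoly (p * q) z = ipoly p z * ipoly q z"
    "ipoly (- p) z = - ipoly p z"
    "ipoly (p - q) z = ipoly p z - ipoly q z"
    by simp_all
  show "ipoly (monom c n) z = of_int c * z ^ n"
    by (simp add: map_poly_monom poly_monom)
qed

lemma ipoly_1 [simp]: "ipoly 1 z = 1"
  by (simp add: map_poly_1')

lemma ipoly_power [simp]: "ipoly (p ^ n) z = ipoly p z ^ n"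
  by (induction n) simp_all

lemma ipoly_sum [simp]: "ipoly (sum f A) z = (\<Sum>a\<in>A. ipoly (f a) z)"
  by (induction A rule: infinite_finite_induct) simp_all

lemma ipoly_prod [simp]: "ipoly (prod f A) z = (\<Prod>a\<in>A. ipoly (f a) z)"
  by (induction A rule: infinite_finite_induct) simp_all

lemma ipoly_of_int: "ipoly p (of_int z) = of_int (poly p z)"
  by (induction p) (simp_all add: map_poly_pCons)

lemma ipoly_at_1: "ipoly p 1 = of_int (poly p 1)"
  using ipoly_of_int[of p 1] by simp

text \<open>Values are algebraic: any fraction equal to the series will do, provided its denominator
  does not vanish at \<open>z\<close>. So \<open>z\<close> may be the inverse of the indeterminate,
  and existence of a value expresses regularity at \<open>z\<close>.\<close>

definition fps_value :: "'b::field_char_0 \<Rightarrow> int fps \<Rightarrow> 'b \<Rightarrow> bool" where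
  "fps_value z f v \<longleftrightarrow> (\<exists>a b. ipoly b z \<noteq> 0 \<and> fps_of_poly b * f = fps_of_poly a \<and> v = ratfun_eval a b z)"

lemma fps_value_of_poly: "fps_value z (fps_of_poly p) (ipoly p z)"
  unfolding fps_value_def ratfun_eval_def by (intro exI[of _ p] exI[of _ 1]) simp

text \<open>Cross-multiplication of two representing fractions is an identity of power series
  between polynomials, hence of polynomials, and may be evaluated at \<open>z\<close>.\<close>

lemma fps_value_unique:
  assumes "fps_value z f u" "fps_value z f v"
  shows "u = v"
proof -
  obtain a b where ab: "ipoly b z \<noteq> 0" "fps_of_poly b * f = fps_of_poly a" "u = ratfun_eval a b z"
    using assms(1) unfolding fps_value_def by blast
  obtain c d where cd: "ipoly d z \<noteq> 0" "fps_of_poly d * f = fps_of_poly c" "v = ratfun_eval c d z"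
    using assms(2) unfolding fps_value_def by blast
  have "fps_of_poly (a * d) = fps_of_poly (c * b)"
    unfolding fps_of_poly_mult ab(2)[symmetric] cd(2)[symmetric] by (simp add: mult_ac)
  then have "a * d = c * b"
    by (simp only: fps_of_poly_eq_iff)
  then have "ipoly a z * ipoly d z = ipoly c z * ipoly b z"
    by (metis ipoly_simps(2))
  then show ?thesis
    using ab cd by (simp add: ratfun_eval_def frac_eq_eq)
qed

lemma fps_value_add:
  assumes "fps_value z f u" "fps_value z g v"
  shows "fps_value z (f + g) (u + v)"
proof -
  obtain a b where ab: "ipoly b z \<noteq> 0" "fps_of_poly b * f = fps_of_poly a" "u = ratfun_eval a b z"
    using assms(1) unfolding fps_value_def by blast
  obtain c d where cd: "ipoly d z \<noteq> 0" "fps_of_poly d * g = fps_of_poly c" "v = ratfun_eval c d z"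
    using assms(2) unfolding fps_value_def by blast
  have "fps_of_poly (b * d) * (f + g) = fps_of_poly (a * d + c * b)"
    unfolding fps_of_poly_mult fps_of_poly_add ab(2)[symmetric] cd(2)[symmetric] by (simp add: algebra_simps)
  moreover have "u + v = ratfun_eval (a * d + c * b) (b * d) z"
    using ab cd by (simp add: ratfun_eval_def add_frac_eq)
  ultimately show ?thesis
    unfolding fps_value_def using ab(1) cd(1)
    by (intro exI[of _ "a * d + c * b"] exI[of _ "b * d"]) simp
qed

lemma fps_value_mult:
  assumes "fps_value z f u" "fps_value z g v"
  shows "fps_value z (f * g) (u * v)"
proof -
  obtain a b where ab: "ipoly b z \<noteq> 0" "fps_of_poly b * f = fps_of_poly a" "u = ratfun_eval a b z"
    using assms(1) unfolding fps_value_def by blast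
  obtain c d where cd: "ipoly d z \<noteq> 0" "fps_of_poly d * g = fps_of_poly c" "v = ratfun_eval c d z"
    using assms(2) unfolding fps_value_def by blast
  have "fps_of_poly (b * d) * (f * g) = fps_of_poly (a * c)"
    unfolding fps_of_poly_mult ab(2)[symmetric] cd(2)[symmetric] by (simp add: mult_ac)
  moreover have "u * v = ratfun_eval (a * c) (b * d) z"
    using ab cd by (simp add: ratfun_eval_def)
  ultimately show ?thesis
    unfolding fps_value_def using ab(1) cd(1)
    by (intro exI[of _ "a * c"] exI[of _ "b * d"]) simp
qed

lemma fps_value_poly_mult:
  "fps_value z f v \<Longrightarrow> fps_value z (fps_of_poly p * f) (ipoly p z * v)"
  by (intro fps_value_mult fps_value_of_poly)

lemma fps_value_sum:
  assumes "\<And>a. a \<in> A \<Longrightarrow> fps_value z (f a) (v a)"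
  shows "fps_value z (\<Sum>a\<in>A. f a) (\<Sum>a\<in>A. v a)"
  using assms
proof (induction A rule: infinite_finite_induct)
  case (insert a A)
  then show ?case
    by (simp add: fps_value_add)
qed (use fps_value_of_poly[of z 0] in simp_all)

lemma fps_value_div:
  assumes "fps_value z (fps_of_poly p * f) u" "ipoly p z \<noteq> 0"
  shows "fps_value z f (u / ipoly p z)"
proof -
  obtain a b where ab: "ipoly b z \<noteq> 0" "fps_of_poly b * (fps_of_poly p * f) = fps_of_poly a"
      "u = ratfun_eval a b z"
    using assms(1) unfolding fps_value_def by blast
  then have "fps_of_poly (b * p) * f = fps_of_poly a" "u / ipoly p z = ratfun_eval a (b * p) z"
    by (simp_all add: fps_of_poly_mult mult.assoc ratfun_eval_def)
  then show ?thesis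
    unfolding fps_value_def using ab(1) assms(2) by (intro exI[of _ a] exI[of _ "b * p"]) simp
qed

section \<open>Fractions in lowest terms\<close>

lemma lowest_terms_dvd:
  assumes "lowest_terms f P Q" "fps_of_poly b * f = fps_of_poly a"
  shows "Q dvd b"
proof -
  have "fps_of_poly (P * b) = fps_of_poly (Q * a)"
    using assms unfolding lowest_terms_def fps_of_poly_mult by (metis mult.assoc mult.commute)
  then have "Q dvd P * b"
    by (simp only: fps_of_poly_eq_iff) simp
  then show ?thesis
    using assms(1) unfolding lowest_terms_def
    by (metis coprime_commute coprime_dvd_mult_right_iff)
qed

lemma lowest_terms_value:
  assumes "lowest_terms f P Q" "fps_value z f v"
  shows "ipoly Q z \<noteq> 0" "ratfun_eval P Q z = v"
proof -
  obtain a b where ab: "ipoly b z \<noteq> 0" "fps_of_poly b * f = fps_of_poly a"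
    using assms(2) unfolding fps_value_def by blast
  then obtain c where "b = Q * c"
    using lowest_terms_dvd[OF assms(1)] by (metis dvdE)
  then show Q: "ipoly Q z \<noteq> 0"
    using ab by auto
  then have "fps_value z f (ratfun_eval P Q z)"
    using assms(1) unfolding fps_value_def lowest_terms_def by metis
  then show "ratfun_eval P Q z = v"
    using assms(2) by (rule fps_value_unique)
qed

lemma lowest_terms_exists:
  assumes "poly b 0 = 1" "fps_of_poly b * f = fps_of_poly a"
  shows "\<exists>P Q. lowest_terms f P Q \<and> Q dvd b"
proof -
  have "b \<noteq> 0"
    using assms(1) by auto
  then have "gcd a b \<noteq> 0"
    by simp
  then obtain P Q where PQ: "a = P * gcd a b" "b = Q * gcd a b" "coprime P Q"
    using gcd_coprime_exists[of a b] by blast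
  have "fps_of_poly (gcd a b) * (fps_of_poly Q * f) = fps_of_poly (gcd a b) * fps_of_poly P"
    using assms(2) PQ(1,2) by (metis fps_of_poly_mult mult.assoc mult.commute)
  moreover have "fps_of_poly (gcd a b) \<noteq> 0"
    using \<open>gcd a b \<noteq> 0\<close> fps_of_poly_eq_iff[of "gcd a b" 0] by simp
  ultimately have eq: "fps_of_poly Q * f = fps_of_poly P"
    using mult_left_cancel by blast
  \<comment> \<open>Both factors are integers, so \<open>Q\<close> has constant term 1 or -1, and
    only the sign of the pair may need correcting.\<close>
  have "poly Q 0 * poly (gcd a b) 0 = 1"
    using assms(1) PQ(2) by (metis poly_mult)
  then have "poly Q 0 = 1 \<or> poly Q 0 = -1"
    using zmult_eq_1_iff by blast
  then show ?thesis
  proof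
    assume "poly Q 0 = 1"
    then have "lowest_terms f P Q"
      using PQ(3) eq by (simp add: lowest_terms_def)
    then show ?thesis
      using PQ(2) by (metis dvd_triv_left)
  next
    assume "poly Q 0 = -1"
    then have "lowest_terms f (- P) (- Q)"
      using PQ(3) eq by (simp add: lowest_terms_def fps_of_poly_uminus)
    then show ?thesis
      using PQ(2) by (metis dvd_triv_left minus_dvd_iff)
  qed
qed

section \<open>The generic point and reversal of polynomials\<close>

lemma ipoly_qvar: "ipoly p qvar = to_fract p"
proof (induction p)
  case (pCons c p)
  have nat: "of_nat m = (to_fract [:int m:] :: int poly fract)" for m
  proof (induction m)
    case (Suc m)
    have "[:int (Suc m):] = 1 + [:int m:]"
      by (simp add: one_pCons)
    then show ?case
      using Suc by (simp only: to_fract_add to_fract_1 of_nat_Suc)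
  qed simp
  have "of_int c = to_fract [:c:]"
  proof (cases c rule: int_cases2)
    case (nonneg n)
    then show ?thesis
      using nat by simp
  next
    case (nonpos n)
    then show ?thesis
      using nat by (simp flip: to_fract_uminus)
  qed
  moreover have "pCons c p = [:c:] + [:0, 1:] * p"
    by simp
  then have "to_fract (pCons c p) = to_fract [:c:] + qvar * to_fract p"
    by (metis to_fract_add to_fract_mult qvar_def)
  ultimately show ?case
    using pCons by (simp add: map_poly_pCons)
qed simp

lemma qvar_nonzero: "qvar \<noteq> 0"
  by (simp add: qvar_def)

text \<open>The constant coefficients differ. This keeps the leading coefficients of the inverted
  recursion nonzero at the generic point.\<close>

lemma qvar_power_neq:
  assumes "n > 0"
  shows "of_int ((-1) ^ k) * qvar ^ n \<noteq> (1 :: int poly fract)"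
proof
  assume "of_int ((-1) ^ k) * qvar ^ n = (1 :: int poly fract)"
  then have "ipoly (monom ((-1) ^ k) n) qvar = (ipoly 1 qvar :: int poly fract)"
    by (simp only: ipoly_simps ipoly_1)
  then have "monom ((-1) ^ k :: int) n = 1"
    unfolding ipoly_qvar to_fract_eq_iff .
  then have "coeff (monom ((-1) ^ k :: int) n) 0 = 1"
    by simp
  then show False
    using assms by simp
qed

lemma ipoly_inverse_qvar: "qvar ^ degree p * ipoly p (inverse qvar) = to_fract (reflect_poly p)"
proof -
  have "reflect_poly (map_poly of_int p) = (map_poly of_int (reflect_poly p) :: int poly fract poly)"
    by (simp add: poly_eq_iff coeff_reflect_poly coeff_map_poly degree_map_poly)
  then show ?thesis
    using poly_reflect_poly_nz[OF qvar_nonzero, of "map_poly of_int p"]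
    by (simp add: degree_map_poly ipoly_qvar)
qed

text \<open>Clearing denominators leaves an equation between \<open>Q * reflect_poly P\<close> and
  \<open>P * reflect_poly Q\<close> up to powers of q. Lowest-order terms give the degrees;
  coprimality makes \<open>Q\<close> divide its reversal, with a constant quotient by
  degree.\<close>

lemma palindromic_of_reciprocity:
  assumes PQ: "coprime P Q" and P0: "poly P 0 \<noteq> 0" and Q0: "poly Q 0 \<noteq> 0" and Q1: "poly Q 1 \<noteq> 0"
    and recip: "ratfun_eval P Q (inverse qvar) = qvar ^ n * ratfun_eval P Q qvar"
  shows "palindromic P" "palindromic Q" "degree Q = degree P + n"
proof -
  have nz: "P \<noteq> 0" "Q \<noteq> 0"
    using P0 Q0 by auto
  then have Qq: "to_fract Q \<noteq> 0" "ipoly Q (inverse qvar) \<noteq> (0 :: int poly fract)"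
    using ipoly_inverse_qvar[of Q] by auto
  have "ipoly P (inverse qvar) * to_fract Q = qvar ^ n * to_fract P * ipoly Q (inverse qvar)"
    using recip Qq by (simp add: ratfun_eval_def ipoly_qvar field_simps)
  then have "qvar ^ degree Q * to_fract Q * (qvar ^ degree P * ipoly P (inverse qvar)) =
      qvar ^ (degree P + n) * to_fract P * (qvar ^ degree Q * ipoly Q (inverse qvar))"
    by (simp add: power_add mult_ac)
  then have "ipoly (monom 1 (degree Q)) qvar * to_fract Q * to_fract (reflect_poly P) =
      ipoly (monom 1 (degree P + n)) qvar * to_fract P * to_fract (reflect_poly Q)"
    by (simp only: ipoly_inverse_qvar ipoly_simps of_int_1 mult_1_left)
  then have "to_fract (monom 1 (degree Q) * (Q * reflect_poly P)) =
      to_fract (monom 1 (degree P + n) * (P * reflect_poly Q))"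
    by (simp only: ipoly_qvar to_fract_mult mult.assoc)
  then have eq: "monom 1 (degree Q) * (Q * reflect_poly P) = monom 1 (degree P + n) * (P * reflect_poly Q)"
    by (simp only: to_fract_eq_iff)
  have cancel: "k = m \<and> f = g" if "monom 1 k * f = monom 1 m * g" "coeff f 0 \<noteq> 0" "coeff g 0 \<noteq> 0"
    for k m and f g :: "int poly"
  proof -
    have "coeff (monom 1 k * f) i = coeff (monom 1 m * g) i" for i
      by (simp only: that(1))
    then have "(if i < k then 0 else coeff f (i - k)) = (if i < m then 0 else coeff g (i - m))" for i
      by (simp add: coeff_monom_mult cong: if_cong)
    from this[of k] this[of m] have "\<not> k < m" "\<not> m < k"
      using that(2,3) by auto
    then have km: "k = m"
      by simp
    have "f = g"
      using that(1) unfolding km by (rule mult_left_cancel[THEN iffD1, rotated]) simp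
    with km show ?thesis
      by blast
  qed
  \<comment> \<open>The constant term of a reversed polynomial is the original leading coefficient,
    so neither product hides a further power of q.\<close>
  have both: "degree Q = degree P + n \<and> Q * reflect_poly P = P * reflect_poly Q"
    by (rule cancel[OF eq]) (use P0 Q0 nz in \<open>simp_all add: coeff_mult poly_0_coeff_0\<close>)
  then show "degree Q = degree P + n"
    by blast
  from both have eq: "Q * reflect_poly P = P * reflect_poly Q"
    by blast
  have "Q dvd reflect_poly Q"
    using eq PQ by (metis coprime_commute coprime_dvd_mult_right_iff dvd_triv_left)
  then obtain c where c: "reflect_poly Q = Q * c"
    by (elim dvdE)
  moreover have "degree (reflect_poly Q) = degree Q"
    using Q0 by (simp add: poly_0_coeff_0)
  moreover have "c \<noteq> 0"
    using c nz by auto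
  ultimately have "degree c = 0"
    using nz by (simp add: degree_mult_eq)
  \<comment> \<open>A polynomial and its reversal agree at 1. Since \<open>Q\<close> does not vanish
    there, the antipalindromic case \<open>c = -1\<close> is excluded.\<close>
  moreover have "poly c 1 = 1"
  proof -
    have "poly (reflect_poly Q) 1 = poly Q 1"
      unfolding poly_altdef using Q0
      by (simp add: poly_0_coeff_0 coeff_reflect_poly)
        (rule sum.reindex_bij_witness[of _ "\<lambda>i. degree Q - i" "\<lambda>i. degree Q - i"], auto)
    then show ?thesis
      using c Q1 by simp
  qed
  ultimately have "c = 1"
    by (elim degree_eq_zeroE) simp
  then show "palindromic Q"
    using c by (simp add: palindromic_def)
  then show "palindromic P"
    using eq nz by (simp add: palindromic_def mult.commute)
qed

section \<open>Consequences of the inverted recursion\<close>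

lemma mag_series_moebius_value:
  assumes "r {} = 0" "finite B" and v: "\<And>A. A \<subseteq> B \<Longrightarrow> fps_value z (mag_series r A) (v A)"
  shows "(\<Sum>A\<in>Pow B. (-1) ^ (card B - card A) * (1 - (-1) ^ r B * z ^ card A) * v A) = 0"
proof -
  let ?p = "\<lambda>A. (-1) ^ (card B - card A) * (1 - monom ((-1) ^ r B) (card A)) :: int poly"
  have "fps_value z (\<Sum>A\<in>Pow B. fps_of_poly (?p A) * mag_series r A) (\<Sum>A\<in>Pow B. ipoly (?p A) z * v A)"
    by (intro fps_value_sum fps_value_poly_mult v) auto
  moreover have "(\<Sum>A\<in>Pow B. fps_of_poly (?p A) * mag_series r A) = fps_of_poly 0"
    using mag_series_moebius[of r, OF assms(1,2)]
    by (simp add: fps_of_poly_mult fps_of_poly_diff fps_of_poly_power fps_of_poly_uminus fps_of_poly_monom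
        fps_const_power[symmetric] flip: fps_const_neg)
  ultimately have "(\<Sum>A\<in>Pow B. ipoly (?p A) z * v A) = 0"
    using fps_value_unique fps_value_of_poly[of z 0] by fastforce
  then show ?thesis
    by simp
qed

text \<open>The linear relation is solved for its top term. The coefficients \<open>p\<close> stay
  general because at \<open>q = 1\<close> the relation is used in a divided form.\<close>

lemma fps_value_top_term:
  assumes B: "finite B" and sum: "(\<Sum>A\<in>Pow B. fps_of_poly (p A) * f A) = 0"
    and v: "\<And>A. A \<subset> B \<Longrightarrow> fps_value z (f A) (v A)" and "ipoly (p B) z \<noteq> 0"
  shows "fps_value z (f B) (- (\<Sum>A\<in>Pow B - {B}. ipoly (p A) z * v A) / ipoly (p B) z)"
proof (rule fps_value_div[OF _ assms(4)])
  have "fps_value z (fps_of_poly (-1) * (\<Sum>A\<in>Pow B - {B}. fps_of_poly (p A) * f A))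
      (ipoly (-1) z * (\<Sum>A\<in>Pow B - {B}. ipoly (p A) z * v A))"
    by (intro fps_value_poly_mult fps_value_sum v) auto
  moreover have "fps_of_poly (p B) * f B + (\<Sum>A\<in>Pow B - {B}. fps_of_poly (p A) * f A) = 0"
    using sum B by (simp add: sum.remove[of "Pow B" B])
  then have "fps_of_poly (p B) * f B = fps_of_poly (-1) * (\<Sum>A\<in>Pow B - {B}. fps_of_poly (p A) * f A)"
    by (simp add: fps_of_poly_uminus add_eq_0_iff2)
  ultimately show "fps_value z (fps_of_poly (p B) * f B) (- (\<Sum>A\<in>Pow B - {B}. ipoly (p A) z * v A))"
    by (simp add: fps_of_poly_uminus)
qed

text \<open>The coefficient of the top series is, up to sign, 1 minus a signed power of
  \<open>z\<close>; the hypothesis on \<open>z\<close> keeps it nonzero, so the induction can divide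
  by it.\<close>

lemma mag_series_value_exists:
  assumes r: "r {} = 0" and z: "\<And>n k. n > 0 \<Longrightarrow> of_int ((-1) ^ k) * z ^ n \<noteq> 1" and "finite B"
  shows "\<exists>v. fps_value z (mag_series r B) v"
  using assms(3)
proof (induction B rule: finite_psubset_induct)
  case (psubset B)
  show ?case
  proof (cases "B = {}")
    case True
    then show ?thesis
      using r fps_value_of_poly[of z 1] by auto
  next
    case False
    obtain v where v: "\<And>A. A \<subset> B \<Longrightarrow> fps_value z (mag_series r A) (v A)"
      using psubset.IH by metis
    let ?p = "\<lambda>A. (-1) ^ (card B - card A) * (1 - monom ((-1) ^ r B) (card A)) :: int poly"
    have "(\<Sum>A\<in>Pow B. fps_of_poly (?p A) * mag_series r A) = 0"
      using mag_series_moebius[of r, OF r psubset.hyps]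
      by (simp add: fps_of_poly_mult fps_of_poly_diff fps_of_poly_power fps_of_poly_uminus fps_of_poly_monom
          fps_const_power[symmetric] flip: fps_const_neg)
    moreover have "ipoly (?p B) z \<noteq> 0"
      using z[of "card B" "r B"] False psubset.hyps by (auto simp: card_gt_0_iff)
    ultimately show ?thesis
      using fps_value_top_term[of B ?p "mag_series r" z v] v psubset.hyps by blast
  qed
qed

lemma mag_series_reciprocity:
  fixes z :: "'b :: field_char_0"
  assumes r: "r {} = 0" and z0: "z \<noteq> 0" and z: "\<And>n k. n > 0 \<Longrightarrow> of_int ((-1) ^ k) * z ^ n \<noteq> 1"
    and u: "\<And>A. finite A \<Longrightarrow> fps_value z (mag_series r A) (u A)"
    and v: "\<And>A. finite A \<Longrightarrow> fps_value (inverse z) (mag_series r A) (v A)"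
    and "finite B"
  shows "v B = z ^ card B * u B"
  using assms(6)
proof (induction B rule: finite_psubset_induct)
  case (psubset B)
  show ?case
  proof (cases "B = {}")
    case True
    have "fps_value y (mag_series r {}) 1" for y :: 'b
      using fps_value_of_poly[of y 1] r by simp
    then have "u {} = 1" "v {} = 1"
      using fps_value_unique u[of "{}"] v[of "{}"] by blast+
    with True show ?thesis
      by simp
  next
    case False
    let ?s = "(-1) ^ r B :: 'b" and ?c = "\<lambda>A. (-1) ^ (card B - card A) * (1 - (-1) ^ r B * inverse z ^ card A) :: 'b"
    have fin: "finite A" if "A \<subseteq> B" for A
      using that psubset.hyps finite_subset by blast
    have "(\<Sum>A\<in>Pow B. ?c A * v A) = 0"
      using v fin by (intro mag_series_moebius_value[where r = r, OF r psubset.hyps]) auto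
    \<comment> \<open>With m = |A| and s = \<open>?s\<close>, s^2 = 1 gives (1 - s z^(-m)) z^m = -s
      (1 - s z^m): the transformed values satisfy the system at \<open>inverse z\<close> with a
      common factor -s.\<close>
    moreover have "(\<Sum>A\<in>Pow B. ?c A * (z ^ card A * u A)) =
        - ?s * (\<Sum>A\<in>Pow B. (-1) ^ (card B - card A) * (1 - ?s * z ^ card A) * u A)"
    proof -
      have "?s * ?s = 1"
        by (simp flip: power_add)
      then have "?c A * (z ^ card A * u A) = - ?s * ((-1) ^ (card B - card A) * (1 - ?s * z ^ card A) * u A)" for A
        using z0 by (simp add: algebra_simps power_inverse)
      then show ?thesis
        by (simp only: sum_distrib_left)
    qed
    moreover have "(\<Sum>A\<in>Pow B. (-1) ^ (card B - card A) * (1 - ?s * z ^ card A) * u A) = 0"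
      using u fin by (intro mag_series_moebius_value[where r = r, OF r psubset.hyps]) auto
    ultimately have "(\<Sum>A\<in>Pow B. ?c A * (v A - z ^ card A * u A)) = 0"
      by (simp add: right_diff_distrib sum_subtractf)
    then have "?c B * (v B - z ^ card B * u B) + (\<Sum>A\<in>Pow B - {B}. ?c A * (v A - z ^ card A * u A)) = 0"
      using psubset.hyps by (simp add: sum.remove[of "Pow B" B])
    moreover have "(\<Sum>A\<in>Pow B - {B}. ?c A * (v A - z ^ card A * u A)) = 0"
      using psubset.IH by (intro sum.neutral) auto
    moreover have "?c B \<noteq> 0"
    proof -
      have "z ^ card B \<noteq> ?s"
        using z[of "card B" "r B"] False psubset.hyps by (auto simp: card_gt_0_iff simp flip: power_add)
      then show ?thesis
        using z0 by (auto simp: power_inverse field_simps)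
    qed
    ultimately show ?thesis
      by simp
  qed
qed

text \<open>Both are Moebius inversions: 1 is the subset sum of the indicator of the empty set, and
  the cardinality is the subset sum of the indicator of singletons.\<close>

lemma sum_alternating_card:
  assumes "finite B"
  shows "(\<Sum>A\<in>Pow B. (-1) ^ (card B - card A)) = (if B = {} then 1 else 0 :: 'b :: comm_ring_1)"
    and "(\<Sum>A\<in>Pow B. (-1) ^ (card B - card A) * of_nat (card A)) = (if card B = 1 then 1 else 0 :: 'b)"
proof -
  have "1 = (\<Sum>A\<in>Pow S. if A = {} then 1 else 0 :: 'b)" if "finite S" for S :: "'a set"
    using that by simp
  from inclusion_exclusion_mobius[of "\<lambda>_. 1", OF this assms]
  show "(\<Sum>A\<in>Pow B. (-1) ^ (card B - card A)) = (if B = {} then 1 else 0 :: 'b)"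
    by simp
  have "of_nat (card S) = (\<Sum>A\<in>Pow S. if card A = 1 then 1 else 0 :: 'b)" if "finite S" for S :: "'a set"
  proof -
    have "Pow S \<inter> {A. card A = 1} = (\<lambda>e. {e}) ` S"
      by (auto simp: card_1_singleton_iff)
    then show ?thesis
      using that by (simp add: sum.If_cases card_image)
  qed
  from inclusion_exclusion_mobius[of "\<lambda>S. of_nat (card S)", OF this assms]
  show "(\<Sum>A\<in>Pow B. (-1) ^ (card B - card A) * of_nat (card A)) = (if card B = 1 then 1 else 0 :: 'b)"
    by simp
qed

text \<open>When \<open>r B\<close> is even, the inverted recursion is divisible by \<open>1 - q\<close>, which removes the
  potential pole at \<open>q = 1\<close>.\<close>

lemma mag_series_value_1:
  assumes r: "r {} = 0" "\<And>e. e \<in> E \<Longrightarrow> odd (r {e})" and "finite B" "B \<subseteq> E"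
  shows "fps_value (1 :: rat) (mag_series r B) 1"
  using assms(3,4)
proof (induction B rule: finite_psubset_induct)
  case (psubset B)
  note moebius = mag_series_moebius[of r, OF r(1) psubset.hyps]
  show ?case
  proof (cases "B = {}")
    case True
    then show ?thesis
      using r fps_value_of_poly[of "1 :: rat" 1] by auto
  next
    case False
    have IH: "fps_value (1 :: rat) (mag_series r A) 1" if "A \<subset> B" for A
      using psubset.IH psubset.prems that by blast
    \<comment> \<open>If the coefficients at 1 sum to zero and all smaller series have value 1, the
      top value must be 1 too.\<close>
    have top: "fps_value (1 :: rat) (mag_series r B) 1"
      if "(\<Sum>A\<in>Pow B. fps_of_poly (p A) * mag_series r A) = 0"
        "(\<Sum>A\<in>Pow B. ipoly (p A) (1 :: rat)) = 0" "ipoly (p B) (1 :: rat) \<noteq> 0" for p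
    proof -
      have "fps_value 1 (mag_series r B) (- (\<Sum>A\<in>Pow B - {B}. ipoly (p A) 1 * 1) / ipoly (p B) (1 :: rat))"
        by (rule fps_value_top_term[OF psubset.hyps that(1) IH that(3)])
      moreover have "(\<Sum>A\<in>Pow B - {B}. ipoly (p A) (1 :: rat)) = - ipoly (p B) 1"
        using that(2) psubset.hyps by (simp add: sum.remove[of "Pow B" B] add_eq_0_iff)
      ultimately show ?thesis
        using that(3) by simp
    qed
    show ?thesis
    proof (cases "even (r B)")
      case True
      \<comment> \<open>The geometric sum is (1 - q^|A|)/(1 - q), with value |A| at 1.\<close>
      let ?p = "\<lambda>A. (-1) ^ (card B - card A) * (\<Sum>i<card A. monom 1 i) :: int poly"
      have "(1 - fps_X) * (\<Sum>A\<in>Pow B. fps_of_poly (?p A) * mag_series r A) =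
          (\<Sum>A\<in>Pow B. (-1) ^ (card B - card A) * (1 - fps_X ^ card A) * mag_series r A)"
        unfolding sum_distrib_left
        by (intro sum.cong refl) (simp add: one_diff_power_eq fps_of_poly_mult fps_of_poly_power
            fps_of_poly_uminus fps_of_poly_sum fps_of_poly_monom mult_ac flip: sum_distrib_left sum_distrib_right)
      also have "\<dots> = 0"
        using moebius True by simp
      finally have "(\<Sum>A\<in>Pow B. fps_of_poly (?p A) * mag_series r A) = 0"
        using fps_X_neq_fps_const[of 1] by auto
      moreover have "card B \<noteq> 1"
        using r(2) psubset.prems True by (auto simp: card_1_singleton_iff)
      then have "(\<Sum>A\<in>Pow B. ipoly (?p A) (1 :: rat)) = 0"
        using sum_alternating_card(2)[OF psubset.hyps, where 'b = rat] by simp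
      moreover have "ipoly (?p B) (1 :: rat) \<noteq> 0"
        using False psubset.hyps by simp
      ultimately show ?thesis
        by (rule top)
    next
      case odd: False
      \<comment> \<open>For odd \<open>r B\<close> the sign turns the factor into 1 + q^|A|, which
        is 2 at 1, so no division is required.\<close>
      let ?p = "\<lambda>A. (-1) ^ (card B - card A) * (1 + monom 1 (card A)) :: int poly"
      have "(\<Sum>A\<in>Pow B. fps_of_poly (?p A) * mag_series r A) = 0"
        using moebius odd by (simp add: fps_of_poly_mult fps_of_poly_power fps_of_poly_uminus fps_of_poly_add
            fps_of_poly_monom)
      moreover have "(\<Sum>A\<in>Pow B. ipoly (?p A) (1 :: rat)) = 0"
        using sum_alternating_card(1)[OF psubset.hyps, where 'b = rat] False
        by (simp flip: sum_distrib_right)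
      moreover have "ipoly (?p B) (1 :: rat) \<noteq> 0"
        by simp
      ultimately show ?thesis
        by (rule top)
    qed
  qed
qed

section \<open>Signed sums of matroid minors\<close>

text \<open>Deletion-contraction: subsets are sorted by whether they contain \<open>e\<close>. If
  \<open>e\<close> raises the rank of \<open>A\<close> by one, the sign makes the two terms
  add.\<close>

lemma minor_sum_split:
  assumes "finite B" "e \<in> B - A"
  shows "minor_sum r A B = minor_sum r A (B - {e}) -
    (-1) ^ (r (insert e A) + r A) * minor_sum r (insert e A) B"
proof -
  let ?g = "\<lambda>S. (-1) ^ (card S + r (A \<union> S) + r A) :: int" and ?D = "B - insert e A"
  have D: "B - A = insert e ?D" "B - {e} - A = ?D"
    using assms(2) by auto
  have "(\<Sum>S\<in>Pow (insert e ?D). ?g S) = (\<Sum>S\<in>Pow ?D. ?g S) + (\<Sum>S\<in>insert e ` Pow ?D. ?g S)"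
    unfolding Pow_insert using assms(1) by (intro sum.union_disjoint) auto
  also have "(\<Sum>S\<in>insert e ` Pow ?D. ?g S) = (\<Sum>S\<in>Pow ?D. ?g (insert e S))"
    by (subst sum.reindex) (auto simp: inj_on_def)
  also have "\<dots> = (\<Sum>S\<in>Pow ?D. - ((-1) ^ (r (insert e A) + r A) *
      (-1) ^ (card S + r (insert e A \<union> S) + r (insert e A))))"
  proof (intro sum.cong refl)
    fix S
    assume S: "S \<in> Pow ?D"
    then have "card (insert e S) = Suc (card S)"
      using assms(1) finite_subset[of S B] by (subst card_insert_disjoint) auto
    then show "?g (insert e S) = - ((-1) ^ (r (insert e A) + r A) *
      (-1) ^ (card S + r (insert e A \<union> S) + r (insert e A)))"
      by (simp add: minus_one_power_iff)
  qed
  finally show ?thesis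
    unfolding minor_sum_def D by (simp add: sum_negf sum_distrib_left)
qed

text \<open>Here \<open>e\<close> is a loop of the minor: deleting and contracting it give the same
  sum, and the two cancel.\<close>

lemma minor_sum_eq_0:
  assumes M: "matroid M" and "finite B" "e \<in> B - A" and e: "rank_of M (insert e A) = rank_of M A"
  shows "minor_sum (rank_of M) A B = 0"
proof -
  have "B - {e} - A = B - insert e A"
    by auto
  moreover have "rank_of M (insert e (A \<union> S)) = rank_of M (A \<union> S)" for S
    by (rule rank_of_insert_eq_mono[OF M _ e]) auto
  ultimately have "minor_sum (rank_of M) A (B - {e}) = minor_sum (rank_of M) (insert e A) B"
    by (simp add: minor_sum_def e)
  then show ?thesis
    using minor_sum_split[OF assms(2,3), of "rank_of M"] e by simp
qed

text \<open>Looplessness of a minor survives deletion but not contraction, where an element parallel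
  to \<open>e\<close> becomes a loop. So both claims share one induction: positivity is taken from
  the deletion, nonnegativity from the contraction.\<close>

lemma minor_sum_pos:
  assumes M: "matroid M" and "finite B" "A \<subseteq> B"
  shows "0 \<le> minor_sum (rank_of M) A B \<and>
    ((\<forall>e\<in>B - A. rank_of M A < rank_of M (insert e A)) \<longrightarrow> 0 < minor_sum (rank_of M) A B)"
  using assms(2,3)
proof (induction "card (B - A)" arbitrary: A B rule: less_induct)
  case less
  show ?case
  proof (cases "\<exists>e\<in>B - A. rank_of M (insert e A) = rank_of M A")
    case True
    then show ?thesis
      using minor_sum_eq_0[OF M less.prems(1)] by force
  next
    case False
    show ?thesis
    proof (cases "B = A")
      case False': False
      then obtain e where e: "e \<in> B - A"
        using less.prems by blast
      have rank: "rank_of M A < rank_of M (insert x A)" if "x \<in> B - A" for x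
        using False that rank_of_mono[OF M, of A "insert x A"] by (metis le_neq_implies_less subset_insertI)
      then have "rank_of M (insert e A) = Suc (rank_of M A)"
        using rank_of_insert_le[OF M, of e A] e by (metis Suc_leI le_antisym)
      then have eq: "minor_sum (rank_of M) A B =
          minor_sum (rank_of M) A (B - {e}) + minor_sum (rank_of M) (insert e A) B"
        using minor_sum_split[OF less.prems(1) e, of "rank_of M"] by simp
      have smaller: "card (B - {e} - A) < card (B - A)" "card (B - insert e A) < card (B - A)"
        by (intro psubset_card_mono finite_Diff; use e less.prems(1) in blast)+
      have "0 < minor_sum (rank_of M) A (B - {e})"
        using less.hyps[OF smaller(1)] less.prems e rank by blast
      moreover have "0 \<le> minor_sum (rank_of M) (insert e A) B"
        using less.hyps[OF smaller(2)] less.prems e by blast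
      ultimately show ?thesis
        using eq by linarith
    qed simp
  qed
qed

text \<open>The rank bound makes the truncated exponent in \<open>charpoly\<close> exact. Asking
  only for this bound lets the formula serve contractions and initial matroids without verifying
  exchange for them.\<close>

lemma R_eq_sum:
  assumes "\<And>S. S \<subseteq> ground N \<Longrightarrow> rank_of N S \<le> total_rank N"
  shows "R N = (\<Sum>S\<in>Pow (ground N). (-1) ^ (card S + rank_of N S))"
  unfolding R_def charpoly_def poly_sum poly_monom sum_distrib_left
proof (intro sum.cong refl)
  fix S
  assume "S \<in> Pow (ground N)"
  then have "rank_of N S \<le> total_rank N"
    using assms by blast
  then show "(-1) ^ total_rank N * ((-1) ^ card S * (-1) ^ (total_rank N - rank_of N S)) =
      (-1 :: int) ^ (card S + rank_of N S)"
    by (auto simp: minus_one_power_iff)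
qed

lemma R_eq_minor_sum:
  assumes M: "matroid M"
  shows "R M = minor_sum (rank_of M) {} (ground M)"
  using R_eq_sum[of M] rank_of_mono[OF M] by (simp add: minor_sum_def rank_of_empty[OF M])

text \<open>A basis adapted to \<open>{e}\<close> inside \<open>insert e S\<close> contains
  \<open>e\<close>, so after removal of \<open>e\<close> it is a basis of the contraction with
  maximal trace on \<open>S\<close>.\<close>

lemma rank_of_contract:
  assumes M: "matroid M" and e: "rank_of M {e} = 1" and S: "e \<notin> S"
  shows "rank_of M (insert e S) = Suc (rank_of (contract M e) S)"
proof -
  have card: "card (B \<inter> insert e S) = Suc (card ((B - {e}) \<inter> S))" if "B \<in> bases M" "e \<in> B" for B
  proof -
    have "B \<inter> insert e S = insert e ((B - {e}) \<inter> S)"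
      using that S by auto
    then show ?thesis
      using matroid_finite(4)[OF M that(1)] by simp
  qed
  have bases: "bases (contract M e) = (\<lambda>B. B - {e}) ` {B \<in> bases M. e \<in> B}"
  proof -
    have "card (B \<inter> {e}) = 1 \<longleftrightarrow> e \<in> B" for B
      by (cases "e \<in> B") auto
    then show ?thesis
      by (auto simp: contract_def e)
  qed
  obtain B where B: "B \<in> bases M" "card (B \<inter> {e}) = rank_of M {e}"
      "card (B \<inter> insert e S) = rank_of M (insert e S)"
  proof -
    define C where "C i = (if i = 0 then {e} else insert e S)" for i :: nat
    have "C i \<subseteq> C j" if "i \<le> j" for i j
      using that by (auto simp: C_def)
    then obtain B where "B \<in> bases M" "\<forall>i\<le>1. card (B \<inter> C i) = rank_of M (C i)"
      using basis_adapted_to_chain[OF M, of 1 C] by blast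
    then have "B \<in> bases M" "card (B \<inter> C 0) = rank_of M (C 0)" "card (B \<inter> C 1) = rank_of M (C 1)"
      by blast+
    then show ?thesis
      using that[of B] by (simp add: C_def)
  qed
  have "e \<in> B"
    using B(2) e by (cases "e \<in> B") auto
  have "rank_of (contract M e) S = card ((B - {e}) \<inter> S)"
    unfolding rank_of_def bases
  proof (rule Max_eqI)
    show "finite ((\<lambda>B. card (B \<inter> S)) ` (\<lambda>B. B - {e}) ` {B \<in> bases M. e \<in> B})"
      using matroid_finite(2)[OF M] by simp
    show "card ((B - {e}) \<inter> S) \<in> (\<lambda>B. card (B \<inter> S)) ` (\<lambda>B. B - {e}) ` {B \<in> bases M. e \<in> B}"
      using B(1) \<open>e \<in> B\<close> by blast
  next
    fix y
    assume "y \<in> (\<lambda>B. card (B \<inter> S)) ` (\<lambda>B. B - {e}) ` {B \<in> bases M. e \<in> B}"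
    then obtain X where X: "X \<in> bases M" "e \<in> X" "y = card ((X - {e}) \<inter> S)"
      by blast
    show "y \<le> card ((B - {e}) \<inter> S)"
      using card_Int_le_rank_of[OF M X(1), of "insert e S"] card[OF X(1,2)] card[OF B(1) \<open>e \<in> B\<close>] B(3) X(3)
      by linarith
  qed
  then show ?thesis
    using card[OF B(1) \<open>e \<in> B\<close>] B(3) by simp
qed

lemma R_contract_eq_minor_sum:
  assumes M: "matroid M" and e: "rank_of M {e} = 1" "e \<in> ground M"
  shows "R (contract M e) = minor_sum (rank_of M) {e} (ground M)"
proof -
  let ?N = "contract M e"
  have ground: "ground ?N = ground M - {e}"
    by (simp add: contract_def)
  have "rank_of ?N S \<le> total_rank ?N" if "S \<subseteq> ground ?N" for S
  proof -
    have "rank_of M (insert e S) \<le> rank_of M (insert e (ground ?N))"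
      using that by (intro rank_of_mono[OF M]) auto
    moreover have "e \<notin> S" "e \<notin> ground ?N"
      using that ground by auto
    ultimately show ?thesis
      using rank_of_contract[OF M e(1)] by simp
  qed
  then have "R ?N = (\<Sum>S\<in>Pow (ground ?N). (-1) ^ (card S + rank_of ?N S))"
    by (rule R_eq_sum)
  also have "\<dots> = minor_sum (rank_of M) {e} (ground M)"
    unfolding minor_sum_def ground
  proof (intro sum.cong refl)
    fix S
    assume "S \<in> Pow (ground M - {e})"
    then have "rank_of M ({e} \<union> S) = Suc (rank_of ?N S)"
      using rank_of_contract[OF M e(1), of S] by auto
    then show "(-1) ^ (card S + rank_of ?N S) = (-1 :: int) ^ (card S + rank_of M ({e} \<union> S) + rank_of M {e})"
      using e by simp
  qed
  finally show ?thesis .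
qed

section \<open>The magnitude\<close>

lemma laurent_eval_m1_superset:
  assumes "finite K" "Poly_Mapping.keys p \<subseteq> K"
  shows "laurent_eval_m1 p = (\<Sum>k\<in>K. Poly_Mapping.lookup p k * (-1) ^ nat \<bar>k\<bar>)"
  unfolding laurent_eval_m1_def using assms
  by (intro sum.mono_neutral_left) (auto simp: in_keys_iff)

lemma laurent_eval_m1_add: "laurent_eval_m1 (p + q) = laurent_eval_m1 p + laurent_eval_m1 q"
proof -
  let ?K = "Poly_Mapping.keys p \<union> Poly_Mapping.keys q"
  show ?thesis
    using laurent_eval_m1_superset[of ?K p] laurent_eval_m1_superset[of ?K q]
      laurent_eval_m1_superset[of ?K "p + q"] Poly_Mapping.keys_add[of p q]
    by (simp add: lookup_add sum.distrib distrib_right)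
qed

lemma laurent_eval_m1_sum: "laurent_eval_m1 (\<Sum>i\<in>I. f i) = (\<Sum>i\<in>I. laurent_eval_m1 (f i))"
  by (induction I rule: infinite_finite_induct) (simp_all add: laurent_eval_m1_add, simp_all add: laurent_eval_m1_def)

lemma laurent_eval_m1_single: "laurent_eval_m1 (Poly_Mapping.single k a) = a * (-1) ^ nat \<bar>k\<bar>"
  using laurent_eval_m1_superset[of "{k}" "Poly_Mapping.single k a"] by simp

lemma laurent_eval_m1_of_poly_shift:
  "laurent_eval_m1 (laurent_of_poly p * Poly_Mapping.single (- int a - int b) 1) =
    poly p (-1) * (-1) ^ (a + b)"
proof -
  \<comment> \<open>Only parity matters: |i - a - b| and i + a + b have the same one.\<close>
  have "(-1) ^ nat \<bar>int i + (- int a - int b)\<bar> = (-1 :: int) ^ i * (-1) ^ (a + b)" for i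
    by (auto simp: minus_one_power_iff even_nat_iff)
  then have "laurent_eval_m1 (laurent_of_poly p * Poly_Mapping.single (- int a - int b) 1) =
      (\<Sum>i\<le>degree p. coeff p i * ((-1) ^ i * (-1) ^ (a + b)))"
    by (simp only: laurent_of_poly_def sum_distrib_right mult_single laurent_eval_m1_sum
        laurent_eval_m1_single mult_1_right)
  then show ?thesis
    by (simp add: poly_altdef sum_distrib_right mult.assoc)
qed

lemma initial_matroid_term:
  assumes M: "matroid M" and K: "\<And>e. e \<in> ground M \<Longrightarrow> w e < K"
  shows "poly (charpoly (initial_matroid M w)) (-1) * (-1) ^ (total_rank M + wt M w) =
    chain_coeff (rank_of M) K (ground M) w"
proof -
  let ?E = "ground M" and ?N = "initial_matroid M w" and ?r = "rank_of M"
  define F where "F = superlevel ?E w"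
  define \<phi> :: "nat \<Rightarrow> 'a set \<Rightarrow> int" where
    "\<phi> t S = (-1) ^ (card S + ?r (F (Suc t) \<union> S) + ?r (F (Suc t)))" for t S
  have wt: "wt M w = (\<Sum>t<K. ?r (F (Suc t)))"
    unfolding F_def by (rule initial_matroid_rank(1)[OF M refl order_refl K])
  have rank: "rank_of ?N S + (\<Sum>t<K. ?r (F (Suc t))) = (\<Sum>t<K. ?r (F (Suc t) \<union> (S \<inter> F t)))"
    if "S \<subseteq> ?E" for S
    unfolding F_def by (rule initial_matroid_rank(2)[OF M refl that K])
  have F: "F 0 = ?E" "F K = {}" "\<And>s t. s \<le> t \<Longrightarrow> F t \<subseteq> F s"
    using K by (auto simp: F_def superlevel_eq_empty superlevel_antimono)
  have ground: "ground ?N = ?E"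
    by (simp add: initial_matroid_def)
  have total: "rank_of ?N ?E = total_rank M"
    using total_rank_initial_matroid[OF M, of w] by (simp add: ground)
  have layers: "(\<Prod>t<K. \<phi> t (S \<inter> (F t - F (Suc t)))) = (-1) ^ (card S + rank_of ?N S)" if S: "S \<subseteq> ?E" for S
  proof -
    have un: "F (Suc t) \<union> (S \<inter> (F t - F (Suc t))) = F (Suc t) \<union> (S \<inter> F t)" for t
      by auto
    have "finite S"
      using S matroid_finite(1)[OF M] finite_subset by blast
    then have "card S = (\<Sum>t<K. card (S \<inter> (F t - F (Suc t))))"
      using card_Int_eq_sum_layers[of S F K] F S by (simp add: Int_absorb2)
    then have "(\<Prod>t<K. \<phi> t (S \<inter> (F t - F (Suc t)))) =
        (-1) ^ (card S + (\<Sum>t<K. ?r (F (Suc t) \<union> (S \<inter> F t))) + (\<Sum>t<K. ?r (F (Suc t))))"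
      by (simp add: \<phi>_def un power_sum[symmetric] sum.distrib)
    also have "\<dots> = (-1) ^ (card S + rank_of ?N S)"
    proof -
      \<comment> \<open>The rank formula has the form k + m = s, so s + m has the parity of the rank
        k in the initial matroid.\<close>
      have parity: "(-1 :: int) ^ (c + s + m) = (-1) ^ (c + k)" if "k + m = s" for c s m k
        unfolding that[symmetric] by (simp add: power_add mult.assoc)
      show ?thesis
        by (rule parity[OF rank[OF S]])
    qed
    finally show ?thesis .
  qed
  have le: "rank_of ?N S \<le> total_rank M" for S
  proof -
    have "finite (bases ?N)"
      using matroid_finite(2)[OF M] by (simp add: initial_matroid_def)
    then have "rank_of ?N S \<in> (\<lambda>B. card (B \<inter> S)) ` bases ?N"
      unfolding rank_of_def using bases_initial_matroid_nonempty[OF M] by (intro Max_in) auto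
    then obtain B where "B \<in> bases M" "rank_of ?N S = card (B \<inter> S)"
      by (auto simp: initial_matroid_def)
    then show ?thesis
      using card_basis_eq_total_rank[OF M] matroid_finite(4)[OF M] by (metis card_mono inf_le1)
  qed
  have "poly (charpoly ?N) (-1) * (-1) ^ (total_rank M + wt M w) = (-1) ^ wt M w * R ?N"
    by (simp add: R_def ground total power_add mult_ac)
  also have "R ?N = (\<Sum>S\<in>Pow ?E. (-1) ^ (card S + rank_of ?N S))"
    using R_eq_sum[of ?N] le by (simp add: ground total)
  also have "\<dots> = (\<Sum>S\<in>Pow (F 0 - F K). \<Prod>t<K. \<phi> t (S \<inter> (F t - F (Suc t))))"
    using F layers by simp
  also have "\<dots> = (\<Prod>t<K. \<Sum>S\<in>Pow (F t - F (Suc t)). \<phi> t S)"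
    by (rule sum_Pow_layers) (rule F(3))
  also have "(-1) ^ wt M w * \<dots> = chain_coeff ?r K ?E w"
    unfolding chain_coeff_def minor_sum_def F_def[symmetric] wt power_sum prod.distrib \<phi>_def ..
  finally show ?thesis .
qed

lemma Mag_eq_mag_series:
  assumes M: "matroid M"
  shows "Mag M = mag_series (rank_of M) (ground M)"
proof (rule fps_ext)
  fix k
  have "Mag M $ k = (\<Sum>w\<in>weights (ground M) k.
      poly (charpoly (initial_matroid M w)) (-1) * (-1) ^ (total_rank M + wt M w))"
    by (simp add: Mag_def zeta_def laurent_eval_m1_sum laurent_eval_m1_of_poly_shift)
  also have "\<dots> = (\<Sum>w\<in>weights (ground M) k. chain_coeff (rank_of M) (Suc k) (ground M) w)"
    by (intro sum.cong refl initial_matroid_term[OF M])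
      (use weights_le[OF matroid_finite(1)[OF M]] in \<open>auto simp: less_Suc_eq_le\<close>)
  finally show "Mag M $ k = mag_series (rank_of M) (ground M) $ k"
    by (simp add: mag_series_def)
qed

text \<open>The factor q^|A| in the recursion leaves only small \<open>A\<close>: the empty set for
  the constant term, singletons for the next one, where the empty set drops out because its series
  is 1.\<close>

lemma mag_series_nth:
  assumes r: "r {} = 0" and B: "finite B"
  shows "mag_series r B $ 0 = minor_sum r {} B"
    and "mag_series r B $ 1 = (\<Sum>e\<in>B. (-1) ^ r {e} * minor_sum r {e} B * minor_sum r {} {e})"
proof -
  have coeff: "mag_series r B $ k = (\<Sum>A\<in>Pow B. (-1) ^ r A * minor_sum r A B *
      (if k < card A then 0 else mag_series r A $ (k - card A)))" if "finite B" for B k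
    by (subst mag_series_rec[of r, OF r that])
      (simp add: fps_sum_nth fps_of_int[symmetric] mult.assoc fps_X_power_mult_nth fps_mult_left_const_nth del: of_int_mult of_int_power)
  have nth_0: "mag_series r B $ 0 = minor_sum r {} B" if "finite B" for B
  proof -
    have "mag_series r B $ 0 = (\<Sum>A\<in>Pow B. if A = {} then minor_sum r {} B else 0)"
      unfolding coeff[OF that]
    proof (intro sum.cong refl)
      fix A
      assume "A \<in> Pow B"
      then have "A \<noteq> {} \<Longrightarrow> 0 < card A"
        using that finite_subset by (auto simp: card_gt_0_iff)
      then show "(-1) ^ r A * minor_sum r A B * (if 0 < card A then 0 else mag_series r A $ (0 - card A)) =
          (if A = {} then minor_sum r {} B else 0)"
        using r by auto
    qed
    then show ?thesis
      using that by simp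
  qed
  show "mag_series r B $ 0 = minor_sum r {} B"
    by (rule nth_0[OF B])
  have "mag_series r B $ 1 = (\<Sum>A\<in>(\<lambda>e. {e}) ` B. (-1) ^ r A * minor_sum r A B * minor_sum r {} A)"
    unfolding coeff[OF B]
  proof (rule sum.mono_neutral_cong_right)
    show "\<forall>A\<in>Pow B - (\<lambda>e. {e}) ` B. (-1) ^ r A * minor_sum r A B *
      (if 1 < card A then 0 else mag_series r A $ (1 - card A)) = 0"
    proof
      fix A
      assume A: "A \<in> Pow B - (\<lambda>e. {e}) ` B"
      then have "finite A" "card A \<noteq> 1"
        using B finite_subset by (auto simp: card_1_singleton_iff)
      then have "A = {} \<or> 1 < card A"
        by (metis One_nat_def card_0_eq less_one linorder_neqE_nat)
      then show "(-1) ^ r A * minor_sum r A B *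
          (if 1 < card A then 0 else mag_series r A $ (1 - card A)) = 0"
        using r by auto
    qed
  qed (use B nth_0 in auto)
  then show "mag_series r B $ 1 = (\<Sum>e\<in>B. (-1) ^ r {e} * minor_sum r {e} B * minor_sum r {} {e})"
    by (simp add: sum.reindex)
qed

text \<open>The recursion before inversion is used, since its kernel vanishes at non-flats. The term
  \<open>A = B\<close> has \<open>minor_sum\<close> equal to 1 and yields the new factor; the other
  flats in \<open>B\<close> contribute denominators dividing \<open>?D'\<close>.\<close>

lemma mag_series_denominator:
  assumes M: "matroid M" and "finite B" "B \<in> flats M"
  shows "\<exists>p. fps_of_poly (\<Prod>A\<in>{A \<in> flats M - {{}}. A \<subseteq> B}. 1 - monom ((-1) ^ rank_of M A) (card A)) *
    mag_series (rank_of M) B = fps_of_poly p"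
  using assms(2,3)
proof (induction B rule: finite_psubset_induct)
  case (psubset B)
  let ?r = "rank_of M" and ?d = "\<lambda>A. 1 - monom ((-1) ^ rank_of M A) (card A) :: int poly"
  let ?D = "\<lambda>B. \<Prod>A\<in>{A \<in> flats M - {{}}. A \<subseteq> B}. ?d A"
  note r = rank_of_empty[OF M]
  show ?case
  proof (cases "B = {}")
    case True
    then have "{A \<in> flats M - {{}}. A \<subseteq> B} = {}"
      by auto
    then show ?thesis
      using True r by (intro exI[of _ 1]) simp
  next
    case False
    let ?D' = "\<Prod>A\<in>{A \<in> flats M - {{}}. A \<subset> B}. ?d A"
    let ?t = "\<lambda>A. (-1) ^ ?r A * minor_sum ?r A B"
    have fin: "finite {A \<in> flats M - {{}}. A \<subset> B}"
      by (rule finite_subset[of _ "Pow B"]) (use psubset.hyps in auto)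
    have "{A \<in> flats M - {{}}. A \<subseteq> B} = insert B {A \<in> flats M - {{}}. A \<subset> B}"
      using psubset.prems False by auto
    then have D: "?D B = ?d B * ?D'"
      using fin by simp
    have "mag_series ?r B = of_int (?t B) * fps_X ^ card B * mag_series ?r B +
        (\<Sum>A\<in>Pow B - {B}. of_int (?t A) * fps_X ^ card A * mag_series ?r A)"
      by (subst mag_series_rec[of ?r, OF r psubset.hyps]) (use psubset.hyps in \<open>simp add: sum.remove[of "Pow B" B]\<close>)
    then have "fps_of_poly (?d B) * mag_series ?r B =
        (\<Sum>A\<in>Pow B - {B}. fps_of_poly (monom (?t A) (card A)) * mag_series ?r A)"
      unfolding left_diff_distrib fps_of_poly_diff fps_of_poly_monom fps_of_int[symmetric] of_int_eq_id id_apply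
      by (simp add: diff_eq_eq add.commute)
    moreover have "fps_of_poly (?D B) * mag_series ?r B =
        fps_of_poly ?D' * (fps_of_poly (?d B) * mag_series ?r B)"
      unfolding D fps_of_poly_mult by (simp only: mult_ac)
    ultimately have eq: "fps_of_poly (?D B) * mag_series ?r B =
        (\<Sum>A\<in>Pow B - {B}. fps_of_poly ?D' * (fps_of_poly (monom (?t A) (card A)) * mag_series ?r A))"
      by (simp only: sum_distrib_left)
    have "\<exists>p. fps_of_poly ?D' * (fps_of_poly (monom (?t A) (card A)) * mag_series ?r A) = fps_of_poly p"
      if A: "A \<in> Pow B - {B}" for A
    proof (cases "A \<in> flats M")
      case True
      then obtain p where p: "fps_of_poly (?D A) * mag_series ?r A = fps_of_poly p"
        using psubset.IH[of A] A by blast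
      have "{C \<in> flats M - {{}}. C \<subseteq> A} \<subseteq> {C \<in> flats M - {{}}. C \<subset> B}"
        using A by auto
      then obtain q where q: "?D' = ?D A * q"
        using fin by (metis (no_types, lifting) prod.subset_diff mult.commute)
      have "fps_of_poly ?D' * (fps_of_poly (monom (?t A) (card A)) * mag_series ?r A) =
          fps_of_poly (q * monom (?t A) (card A)) * (fps_of_poly (?D A) * mag_series ?r A)"
        unfolding q fps_of_poly_mult by (simp only: mult_ac)
      also have "\<dots> = fps_of_poly (q * monom (?t A) (card A) * p)"
        unfolding p by (simp only: fps_of_poly_mult)
      finally show ?thesis
        by blast
    next
      case False
      have "A \<subseteq> B" "B \<subseteq> ground M"
        using A psubset.prems by (auto simp: flats_def)
      then obtain e where e: "e \<in> ground M - A" "\<not> ?r A < ?r (insert e A)"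
        using False by (auto simp: flats_def)
      then have same: "?r (insert e A) = ?r A"
        using rank_of_mono[OF M, of A "insert e A"] by (metis le_neq_implies_less subset_insertI)
      \<comment> \<open>\<open>e\<close> lies in the closure of \<open>A\<close>, which the flat
        \<open>B\<close> contains; so \<open>e\<close> is a loop of the minor between
        \<open>A\<close> and \<open>B\<close>.\<close>
      have "e \<in> B"
      proof (rule ccontr)
        assume "e \<notin> B"
        then have "?r B < ?r (insert e B)"
          using psubset.prems e by (auto simp: flats_def)
        then show False
          using rank_of_insert_eq_mono[OF M \<open>A \<subseteq> B\<close> same] by simp
      qed
      then have "minor_sum ?r A B = 0"
        using minor_sum_eq_0[OF M psubset.hyps _ same] e by blast
      then show ?thesis
        by (intro exI[of _ 0]) simp
    qed
    then have "\<forall>A\<in>Pow B - {B}. \<exists>p.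
        fps_of_poly ?D' * (fps_of_poly (monom (?t A) (card A)) * mag_series ?r A) = fps_of_poly p"
      by blast
    then obtain p where p: "\<forall>A\<in>Pow B - {B}.
        fps_of_poly ?D' * (fps_of_poly (monom (?t A) (card A)) * mag_series ?r A) = fps_of_poly (p A)"
      by (rule bchoice[THEN exE])
    have "fps_of_poly (?D B) * mag_series ?r B = fps_of_poly (\<Sum>A\<in>Pow B - {B}. p A)"
      unfolding eq fps_of_poly_sum by (rule sum.cong[OF refl]) (rule bspec[OF p])
    then show ?thesis
      by blast
  qed
qed

theorem theorem4p2:
  fixes M :: "'a set_system" and r n :: nat
  assumes "matroid M" and "loopless M"
    and "total_rank M = r" and "card (ground M) = n"
  shows
    "(\<exists>P Q. lowest_terms (Mag M) P Q \<and>
        Q dvd (\<Prod>A\<in>flats M - {{}}. 1 - monom ((-1) ^ rank_of M A) (card A))) \<and>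
     (fps_nth (Mag M) 0 = R M \<and>
      fps_nth (Mag M) 1 = - 2 * (\<Sum>e\<in>{e \<in> ground M. {e} \<in> flats M}. R (contract M e))) \<and>
     (\<forall>P Q. lowest_terms (Mag M) P Q \<longrightarrow>
        ratfun_eval P Q (inverse qvar) = qvar ^ n * ratfun_eval P Q qvar) \<and>
     (\<forall>P Q. lowest_terms (Mag M) P Q \<longrightarrow>
        poly Q 1 \<noteq> 0 \<and> ratfun_eval P Q (1 :: rat) = 1) \<and>
     (\<forall>P Q. lowest_terms (Mag M) P Q \<longrightarrow>
        palindromic P \<and> palindromic Q \<and>
        int (degree Q) - int (degree P) = int n \<and>
        (\<forall>z :: complex. poly (map_poly of_int Q) z = 0 \<longrightarrow>
           (\<exists>k>0. z ^ k = 1) \<and> z \<noteq> 1))"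
proof -
  note M = assms(1)
  let ?E = "ground M" and ?r = "rank_of M"
  let ?D = "\<Prod>A\<in>flats M - {{}}. 1 - monom ((-1) ^ rank_of M A) (card A) :: int poly"
  have fin: "finite ?E"
    using matroid_finite(1)[OF M] .
  have r0: "?r {} = 0"
    using rank_of_empty[OF M] .
  have r1: "?r {e} = 1" if "e \<in> ?E" for e
    using assms(2) that rank_of_insert_le[OF M, of e "{}"] r0 by (auto simp: loopless_def)
  note Mag = Mag_eq_mag_series[OF M]
  have flats: "A \<subseteq> ?E \<and> finite A" if "A \<in> flats M" for A
    using that fin finite_subset by (auto simp: flats_def)

  obtain N where N: "fps_of_poly ?D * Mag M = fps_of_poly N"
  proof -
    have "?E \<in> flats M"
      by (simp add: flats_def)
    moreover have "{A \<in> flats M - {{}}. A \<subseteq> ?E} = flats M - {{}}"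
      using flats by auto
    ultimately show ?thesis
      using mag_series_denominator[OF M fin] that by (auto simp: Mag)
  qed
  have "poly ?D 0 = 1"
    using flats by (auto simp: poly_prod poly_monom card_gt_0_iff intro!: prod.neutral)
  then have part1: "\<exists>P Q. lowest_terms (Mag M) P Q \<and> Q dvd ?D"
    using lowest_terms_exists N by blast

  have part2a: "Mag M $ 0 = R M"
    by (simp add: Mag mag_series_nth[of ?r, OF r0 fin] R_eq_minor_sum[OF M])
  have part2b: "Mag M $ 1 = - 2 * (\<Sum>e\<in>{e \<in> ?E. {e} \<in> flats M}. R (contract M e))"
  proof -
    \<comment> \<open>This 2, with the sign from the odd rank of \<open>{e}\<close>, is the origin
      of the constant -2.\<close>
    have two: "minor_sum ?r {} {e} = 2" if "e \<in> ?E" for e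
    proof -
      have "Pow ({e} - {}) = {{}, {e}}"
        by auto
      then show ?thesis
        by (simp add: minor_sum_def r0 r1[OF that])
    qed
    have not_flat: "minor_sum ?r {e} ?E = 0" if "e \<in> ?E" "{e} \<notin> flats M" for e
    proof -
      obtain x where x: "x \<in> ?E - {e}" "\<not> ?r {e} < ?r (insert x {e})"
        using \<open>{e} \<notin> flats M\<close> \<open>e \<in> ?E\<close> by (auto simp: flats_def)
      then have "?r (insert x {e}) = ?r {e}"
        using rank_of_mono[OF M, of "{e}" "insert x {e}"] by (metis le_neq_implies_less subset_insertI)
      then show ?thesis
        using minor_sum_eq_0[OF M fin x(1)] by blast
    qed
    have "Mag M $ 1 = (\<Sum>e\<in>?E. - 2 * minor_sum ?r {e} ?E)"
      unfolding Mag mag_series_nth(2)[of ?r, OF r0 fin] by (intro sum.cong) (simp_all add: r1 two)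
    also have "\<dots> = (\<Sum>e\<in>{e \<in> ?E. {e} \<in> flats M}. - 2 * R (contract M e))"
      using fin not_flat r1 R_contract_eq_minor_sum[OF M] by (intro sum.mono_neutral_cong_right) auto
    finally show ?thesis
      by (simp add: sum_distrib_left)
  qed

  have part3: "ratfun_eval P Q (inverse qvar) = qvar ^ n * ratfun_eval P Q qvar"
    if PQ: "lowest_terms (Mag M) P Q" for P Q
  proof -
    have neq: "of_int ((-1) ^ k) * inverse qvar ^ m \<noteq> (1 :: int poly fract)" if "m > 0" for k m
    proof
      assume "of_int ((-1) ^ k) * inverse qvar ^ m = (1 :: int poly fract)"
      then have "of_int ((-1) ^ k) * qvar ^ m = (1 :: int poly fract)"
        using qvar_nonzero by (auto simp: minus_one_power_iff power_inverse field_simps split: if_splits)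
      then show False
        using qvar_power_neq[OF that] by blast
    qed
    obtain u where u: "\<And>A. finite A \<Longrightarrow> fps_value (qvar :: int poly fract) (mag_series ?r A) (u A)"
      using mag_series_value_exists[of ?r "qvar :: int poly fract", OF r0 qvar_power_neq] by metis
    obtain v where v: "\<And>A. finite A \<Longrightarrow> fps_value (inverse qvar :: int poly fract) (mag_series ?r A) (v A)"
      using mag_series_value_exists[of ?r "inverse qvar :: int poly fract", OF r0 neq] by metis
    have "v ?E = qvar ^ card ?E * u ?E"
      by (rule mag_series_reciprocity[of ?r, OF r0 qvar_nonzero qvar_power_neq u v fin])
    then show ?thesis
      using lowest_terms_value(2)[OF PQ[unfolded Mag]] u[OF fin] v[OF fin] assms(4) by metis
  qed

  have part4: "poly Q 1 \<noteq> 0 \<and> ratfun_eval P Q (1 :: rat) = 1" if PQ: "lowest_terms (Mag M) P Q" for P Q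
  proof -
    have "fps_value (1 :: rat) (Mag M) 1"
      unfolding Mag by (rule mag_series_value_1[of ?r, OF r0 _ fin order_refl]) (simp add: r1)
    from lowest_terms_value[OF PQ this] show ?thesis
      by (simp add: ipoly_at_1)
  qed

  have part5: "palindromic P \<and> palindromic Q \<and> int (degree Q) - int (degree P) = int n \<and>
      (\<forall>z :: complex. ipoly Q z = 0 \<longrightarrow> (\<exists>k>0. z ^ k = 1) \<and> z \<noteq> 1)"
    if PQ: "lowest_terms (Mag M) P Q" for P Q
  proof -
    have lt: "coprime P Q" "poly Q 0 = 1" "fps_of_poly P = fps_of_poly Q * Mag M"
      using PQ by (auto simp: lowest_terms_def)
    \<comment> \<open>Looplessness says that every element raises the rank of the empty set.
      Positivity makes the constant term of \<open>P\<close> nonzero, as palindromicity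
      requires.\<close>
    have "0 < R M"
      unfolding R_eq_minor_sum[OF M] using minor_sum_pos[OF M fin, of "{}"] r0 r1 by simp
    moreover have "poly P 0 = poly Q 0 * Mag M $ 0"
      using arg_cong[OF lt(3), of "\<lambda>f. f $ 0"] by (simp add: poly_0_coeff_0 fps_mult_nth)
    ultimately have "poly P 0 \<noteq> 0"
      using lt(2) part2a by simp
    then have "palindromic P" "palindromic Q" "degree Q = degree P + n"
      using palindromic_of_reciprocity[OF lt(1) _ _ _ part3[OF PQ]] lt(2) part4[OF PQ] by auto
    moreover have "(\<exists>k>0. z ^ k = 1) \<and> z \<noteq> 1" if z: "ipoly Q z = 0" for z :: complex
    proof
      have "Q dvd ?D"
        by (rule lowest_terms_dvd[OF PQ N])
      then obtain S where S: "?D = Q * S"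
        by (elim dvdE)
      have "ipoly ?D z = 0"
        unfolding S by (simp only: ipoly_simps z mult_zero_left)
      moreover have "finite (flats M - {{}})"
        using flats fin finite_subset[of "flats M" "Pow ?E"] by auto
      ultimately obtain A where A: "A \<in> flats M - {{}}" "1 - (-1) ^ ?r A * z ^ card A = 0"
        by auto
      then have "z ^ card A = 1 \<or> z ^ card A = -1"
        by (cases "even (?r A)") (auto simp: add_eq_0_iff)
      \<comment> \<open>Squaring removes the sign coming from the parity of the rank.\<close>
      then have "z ^ (2 * card A) = 1"
        by (auto simp: power_even_eq)
      then show "\<exists>k>0. z ^ k = 1"
        using A(1) flats by (intro exI[of _ "2 * card A"]) (auto simp: card_gt_0_iff)
      \<comment> \<open>This comes from regularity at 1, not from \<open>?D\<close>, whose factors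
        for flats of even rank vanish there.\<close>
      show "z \<noteq> 1"
        using z part4[OF PQ] by (auto simp: ipoly_at_1)
    qed
    ultimately show ?thesis
      by auto
  qed
  show ?thesis
    using part1 part2a part2b part3 part4 part5 by blast
qed

end
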